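(* Let $W$ be a graphon and $\mathcal P=\{S_1,\dots,S_n\}$ a partition of $[0,1]$ into measurable sets. Then $\overline{\mathrm{cd}}(W)\le\overline{\mathrm{cd}}(W_{\mathcal P})$ and $\mathrm{cd}(W)\le\mathrm{cd}(W_{\mathcal P})$.
   Context: A graphon is a symmetric measurable $W:[0,1]^2\to[0,1]$; $\lambda$ is Lebesgue measure. $W_{\mathcal P}$ is the graphon with $W_{\mathcal P}(x,y)=\frac{1}{\lambda(S_i)\lambda(S_j)}\int_{S_i\times S_j}W$ for $x\in S_i$, $y\in S_j$. For $x,y,z,w\in\mathbb R^2$, $I(x,y,z,w)=1$ if $\mathrm{conv}\{x,y\}\cap\mathrm{conv}\{z,w\}\ne\emptyset$, else $0$; $\mathcal F$ is the family of bounded measurable $f:[0,1]\to\mathbb R^2$; $\overline{\mathrm{cd}}(W)=\inf_{f\in\mathcal F}\frac18\int_{[0,1]^4}W(x_1,x_2)W(x_3,x_4)I(f(x_1),f(x_2),f(x_3),f(x_4))\prod dx_i$. $\mathcal C$ is the set of simple or constant curves $[0,1]\to\mathbb R^2$. A simple graphon drawing is $\mathcal D:[0,1]^2\to\mathcal C$ with: (1) $\mathcal D(x,y)(t)=\mathcal D(y,x)(1-t)$; (2) $\mathcal D(x,x)$ has a single point $\mathcal D(x)$ as image; (3) $\mathcal D(x,y)(0)=\mathcal D(x)$; (4) if images of $\mathcal D(x_1,y_1)$, $\mathcal D(x_2,y_2)$ differ as sets they share at most one point. $I_{\mathcal D}(x,y,z,w)=1$ iff $\mathcal D(x,y)$ and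 $\mathcal D(z,w)$ share a point, else $0$; $\mathcal D_{\mathcal W}$ = simple graphon drawings with $I_{\mathcal D}$ measurable; $\mathrm{cd}(W)=\inf_{\mathcal D\in\mathcal D_{\mathcal W}}\frac18\int_{[0,1]^4}W(x_1,x_2)W(x_3,x_4)I_{\mathcal D}(x_1,x_2,x_3,x_4)\prod dx_i$. *)

theory Defs
  imports "HOL-Analysis.Analysis"
begin

(* Functions on [0,1] are total functions on real; only their values on [0,1] matter.
   "Measurable" means Lebesgue measurable throughout. *)

definition graphon :: "(real \<Rightarrow> real \<Rightarrow> real) \<Rightarrow> bool" where
  "graphon W \<longleftrightarrow>
     (\<lambda>(x, y). W x y) \<in> borel_measurable (lebesgue_on ({0..1} \<times> {0..1})) \<and>
     (\<forall>x\<in>{0..1}. \<forall>y\<in>{0..1}. W x y = W y x \<and> 0 \<le> W x y \<and> W x y \<le> 1)"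

definition part_of :: "'a set set \<Rightarrow> 'a \<Rightarrow> 'a set" where
  "part_of P x = (THE S. S \<in> P \<and> x \<in> S)"

(* The average over a rectangle with a null side is 0, by division by zero;
   this only concerns a null set of points (x, y). *)
definition step_graphon :: "real set set \<Rightarrow> (real \<Rightarrow> real \<Rightarrow> real) \<Rightarrow> real \<Rightarrow> real \<Rightarrow> real" where
  "step_graphon P W x y =
     1 / (measure lebesgue (part_of P x) * measure lebesgue (part_of P y)) *
     (\<integral>(u, v). W u v \<partial>lebesgue_on (part_of P x \<times> part_of P y))"

abbreviation unit_cube4 :: "(real \<times> real \<times> real \<times> real) set" where
  "unit_cube4 \<equiv> {0..1} \<times> {0..1} \<times> {0..1} \<times> {0..1}"

definition crossing_integral ::
    "(real \<Rightarrow> real \<Rightarrow> real) \<Rightarrow> (real \<Rightarrow> real \<Rightarrow> real \<Rightarrow> real \<Rightarrow> real) \<Rightarrow> real" where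
  "crossing_integral W J =
     1 / 8 * (\<integral>(x1, x2, x3, x4). W x1 x2 * W x3 x4 * J x1 x2 x3 x4 \<partial>lebesgue_on unit_cube4)"

definition segments_meet :: "real^2 \<Rightarrow> real^2 \<Rightarrow> real^2 \<Rightarrow> real^2 \<Rightarrow> real" where
  "segments_meet x y z w = of_bool (convex hull {x, y} \<inter> convex hull {z, w} \<noteq> {})"

definition vertex_placements :: "(real \<Rightarrow> real^2) set" where
  "vertex_placements = {f. f \<in> borel_measurable (lebesgue_on {0..1}) \<and> bounded (f ` {0..1})}"

definition rectilinear_crossing_density :: "(real \<Rightarrow> real \<Rightarrow> real) \<Rightarrow> real" where
  "rectilinear_crossing_density W =
     (INF f\<in>vertex_placements.
        crossing_integral W (\<lambda>x1 x2 x3 x4. segments_meet (f x1) (f x2) (f x3) (f x4)))"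

(* A simple curve is injective on all of [0,1], hence "arc" rather than "simple_path",
   which also admits closed curves. *)
definition drawing_curves :: "(real \<Rightarrow> real^2) set" where
  "drawing_curves = {c. arc c \<or> c constant_on {0..1}}"

(* the_elem is meaningful here because simple_graphon_drawing requires a singleton image. *)
definition drawing_vertex :: "(real \<Rightarrow> real \<Rightarrow> real \<Rightarrow> real^2) \<Rightarrow> real \<Rightarrow> real^2" where
  "drawing_vertex D x = the_elem (path_image (D x x))"

definition simple_graphon_drawing :: "(real \<Rightarrow> real \<Rightarrow> real \<Rightarrow> real^2) \<Rightarrow> bool" where
  "simple_graphon_drawing D \<longleftrightarrow>
     (\<forall>x\<in>{0..1}. \<forall>y\<in>{0..1}. D x y \<in> drawing_curves) \<and>
     (\<forall>x\<in>{0..1}. \<forall>y\<in>{0..1}. \<forall>t\<in>{0..1}. D x y t = D y x (1 - t)) \<and>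
     (\<forall>x\<in>{0..1}. is_singleton (path_image (D x x))) \<and>
     (\<forall>x\<in>{0..1}. \<forall>y\<in>{0..1}. D x y 0 = drawing_vertex D x) \<and>
     (\<forall>x1\<in>{0..1}. \<forall>y1\<in>{0..1}. \<forall>x2\<in>{0..1}. \<forall>y2\<in>{0..1}.
        path_image (D x1 y1) \<noteq> path_image (D x2 y2) \<longrightarrow>
        (\<exists>p. path_image (D x1 y1) \<inter> path_image (D x2 y2) \<subseteq> {p}))"

definition curves_meet ::
    "(real \<Rightarrow> real \<Rightarrow> real \<Rightarrow> real^2) \<Rightarrow> real \<Rightarrow> real \<Rightarrow> real \<Rightarrow> real \<Rightarrow> real" where
  "curves_meet D x y z w = of_bool (path_image (D x y) \<inter> path_image (D z w) \<noteq> {})"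

definition measurable_drawings :: "(real \<Rightarrow> real \<Rightarrow> real \<Rightarrow> real^2) set" where
  "measurable_drawings =
     {D. simple_graphon_drawing D \<and>
         (\<lambda>(x, y, z, w). curves_meet D x y z w) \<in> borel_measurable (lebesgue_on unit_cube4)}"

definition crossing_density :: "(real \<Rightarrow> real \<Rightarrow> real) \<Rightarrow> real" where
  "crossing_density W = (INF D\<in>measurable_drawings. crossing_integral W (curves_meet D))"

end

theory Submission
  imports Defs "HOL-Probability.Infinite_Product_Measure"
begin

text \<open>
  Both densities are infima over drawings that can be pulled back along a map \<open>\<phi>\<close> from
  \<open>[0,1]\<close> to itself, so it suffices to find, for a crossing kernel \<open>J\<close>, a \<open>\<phi>\<close> for which the
  integral of \<open>W(x1,x2) W(x3,x4) J(\<phi> x1,\<phi> x2,\<phi> x3,\<phi> x4)\<close> exceeds the integral of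
  \<open>W\<^sub>P(x1,x2) W\<^sub>P(x3,x4) J(x1,x2,x3,x4)\<close> by at most \<open>O(1/n)\<close>. Cut every part \<open>S\<close> into pieces of
  measure at most \<open>1/n\<close> and let \<open>\<phi>\<close> send each piece to one point, chosen independently and
  uniformly in \<open>S\<close>. If \<open>x1,...,x4\<close> lie in different pieces, the expectation of \<open>J \<circ> \<phi>\<close> is the
  average of \<open>J\<close> over the box of their parts; otherwise it is at most 1, which happens on a set
  of measure at most \<open>6/n\<close>. Averaging over boxes is self-adjoint, so it can be moved from \<open>J\<close> to
  \<open>W\<close>, where it yields \<open>W\<^sub>P\<close>. Some choice of points does at least as well as the expectation.
\<close>

section \<open>Lebesgue measure on products\<close>

text \<open>The cylinder \<open>N \<times> UNIV\<close> over a null set is null although its second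
  side has infinite measure, because 0 * \<infinity> = 0 in \<open>ennreal\<close>.\<close>

lemma AE_lborel_fst:
  assumes "AE x in lborel. Q x"
  shows "AE z in (lborel :: ('a::euclidean_space \<times> 'b::euclidean_space) measure). Q (fst z)"
proof -
  obtain N where N: "N \<in> null_sets lborel" "{x. \<not> Q x} \<subseteq> N"
    using assms by (auto simp: eventually_ae_filter)
  have "N \<times> UNIV \<in> null_sets (lborel \<Otimes>\<^sub>M (lborel :: 'b measure))"
    using N(1) by (auto simp: null_sets_def lborel.emeasure_pair_measure_Times)
  then show ?thesis
    using N(2) by (intro AE_I'[of "N \<times> UNIV"]) (auto simp: lborel_prod)
qed

lemma AE_lborel_snd:
  assumes "AE x in lborel. Q x"
  shows "AE z in (lborel :: ('a::euclidean_space \<times> 'b::euclidean_space) measure). Q (snd z)"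
proof -
  obtain N where N: "N \<in> null_sets lborel" "{x. \<not> Q x} \<subseteq> N"
    using assms by (auto simp: eventually_ae_filter)
  have "UNIV \<times> N \<in> null_sets ((lborel :: 'a measure) \<Otimes>\<^sub>M lborel)"
    using N(1) by (auto simp: null_sets_def lborel.emeasure_pair_measure_Times)
  then show ?thesis
    using N(2) by (intro AE_I'[of "UNIV \<times> N"]) (auto simp: lborel_prod)
qed

text \<open>The Borel projection stays measurable after completing both sides because the preimage
  of a null set is a null cylinder.\<close>

lemma lebesgue_measurable_fst:
  "fst \<in> (lebesgue :: ('a::euclidean_space \<times> 'b::euclidean_space) measure) \<rightarrow>\<^sub>M lebesgue"
proof (rule completion.measurable_completion2)
  show m: "fst \<in> (lebesgue :: ('a \<times> 'b) measure) \<rightarrow>\<^sub>M lborel"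
    by (intro measurable_completion) (simp add: borel_prod[symmetric])
  show "null_sets lborel \<subseteq> null_sets (distr (lebesgue :: ('a \<times> 'b) measure) lborel fst)"
  proof
    fix N :: "'a set" assume N: "N \<in> null_sets lborel"
    have "AE z in (lborel :: ('a \<times> 'b) measure). fst z \<notin> N"
      by (intro AE_lborel_fst AE_not_in N)
    then have "AE z in distr (lebesgue :: ('a \<times> 'b) measure) lborel fst. z \<notin> N"
      using m N by (subst AE_distr_iff) (auto intro!: AE_completion)
    then show "N \<in> null_sets (distr (lebesgue :: ('a \<times> 'b) measure) lborel fst)"
      using N by (subst AE_iff_null_sets) auto
  qed
qed

lemma lebesgue_measurable_snd:
  "snd \<in> (lebesgue :: ('a::euclidean_space \<times> 'b::euclidean_space) measure) \<rightarrow>\<^sub>M lebesgue"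
proof (rule completion.measurable_completion2)
  show m: "snd \<in> (lebesgue :: ('a \<times> 'b) measure) \<rightarrow>\<^sub>M lborel"
    by (intro measurable_completion) (simp add: borel_prod[symmetric])
  show "null_sets lborel \<subseteq> null_sets (distr (lebesgue :: ('a \<times> 'b) measure) lborel snd)"
  proof
    fix N :: "'b set" assume N: "N \<in> null_sets lborel"
    have "AE z in (lborel :: ('a \<times> 'b) measure). snd z \<notin> N"
      by (intro AE_lborel_snd AE_not_in N)
    then have "AE z in distr (lebesgue :: ('a \<times> 'b) measure) lborel snd. z \<notin> N"
      using m N by (subst AE_distr_iff) (auto intro!: AE_completion)
    then show "N \<in> null_sets (distr (lebesgue :: ('a \<times> 'b) measure) lborel snd)"
      using N by (subst AE_iff_null_sets) auto
  qed
qed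

lemma lebesgue_sets_Times:
  fixes A :: "'a::euclidean_space set" and B :: "'b::euclidean_space set"
  assumes "A \<in> sets lebesgue" "B \<in> sets lebesgue"
  shows "A \<times> B \<in> sets lebesgue"
proof -
  have "A \<times> B = (fst -` A \<inter> space lebesgue) \<inter> (snd -` B \<inter> space lebesgue)"
    by auto
  then show ?thesis
    using measurable_sets[OF lebesgue_measurable_fst assms(1)]
      measurable_sets[OF lebesgue_measurable_snd assms(2)] by (metis sets.Int)
qed

text \<open>Replacing each side by its Borel \<open>main_part\<close> changes the rectangle only
  inside two null cylinders, and on Borel rectangles \<open>lborel\<close> is a product
  measure.\<close>

lemma emeasure_lebesgue_Times:
  fixes A :: "'a::euclidean_space set" and B :: "'b::euclidean_space set"
  assumes A: "A \<in> sets lebesgue" and B: "B \<in> sets lebesgue"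
  shows "emeasure lebesgue (A \<times> B) = emeasure lebesgue A * emeasure lebesgue B"
proof -
  let ?A = "main_part lborel A" and ?B = "main_part lborel B"
  have s: "?A \<in> sets borel" "?B \<in> sets borel"
    using main_part_sets[OF A] main_part_sets[OF B] by simp_all
  have b: "?A \<times> ?B \<in> sets borel"
    using s by (rule borel_Times)
  have "AE z in lebesgue. fst z \<in> ?A \<longleftrightarrow> fst z \<in> A"
    by (intro AE_completion AE_lborel_fst AE_in_main_part A)
  moreover have "AE z in lebesgue. snd z \<in> ?B \<longleftrightarrow> snd z \<in> B"
    by (intro AE_completion AE_lborel_snd AE_in_main_part B)
  ultimately have "AE z in lebesgue. z \<in> A \<times> B \<longleftrightarrow> z \<in> ?A \<times> ?B"
    by eventually_elim auto
  then have "emeasure lebesgue (A \<times> B) = emeasure lebesgue (?A \<times> ?B)"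
    using lebesgue_sets_Times[OF A B] b by (intro emeasure_eq_AE) auto
  also have "\<dots> = emeasure lborel (?A \<times> ?B)"
    using b by (subst emeasure_completion) (auto simp: main_part_sets)
  also have "\<dots> = emeasure lborel ?A * emeasure lborel ?B"
    using s by (subst lborel_prod[symmetric]) (simp add: lborel.emeasure_pair_measure_Times)
  finally show ?thesis
    using A B by simp
qed

text \<open>Lebesgue measure on a rectangle lives on a larger sigma-algebra than the product of the
  measures on its sides, so the two are linked by a measure-preserving identity map and not by an
  equation. \<open>Y\<close> stands for a measure on \<open>B\<close> that may itself be such a
  product, which lets the lemma be iterated.\<close>

lemma lebesgue_on_Times:
  fixes A :: "'a::euclidean_space set" and B :: "'b::euclidean_space set"
  assumes A: "A \<in> sets lebesgue" and B: "B \<in> sets lebesgue"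
    and id: "(\<lambda>x. x) \<in> lebesgue_on B \<rightarrow>\<^sub>M Y" and distr: "distr (lebesgue_on B) Y (\<lambda>x. x) = Y"
    and sf: "sigma_finite_measure Y" "sigma_finite_measure (lebesgue_on A)"
    and sp: "space Y = B"
  shows "(\<lambda>x. x) \<in> lebesgue_on (A \<times> B) \<rightarrow>\<^sub>M lebesgue_on A \<Otimes>\<^sub>M Y"
    and "distr (lebesgue_on (A \<times> B)) (lebesgue_on A \<Otimes>\<^sub>M Y) (\<lambda>x. x) = lebesgue_on A \<Otimes>\<^sub>M Y"
proof -
  have 1: "fst \<in> lebesgue_on (A \<times> B) \<rightarrow>\<^sub>M lebesgue_on A"
    by (rule measurable_restrict_space3[OF lebesgue_measurable_fst]) auto
  have "snd \<in> lebesgue_on (A \<times> B) \<rightarrow>\<^sub>M lebesgue_on B"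
    by (rule measurable_restrict_space3[OF lebesgue_measurable_snd]) auto
  from measurable_compose[OF this id] have 2: "snd \<in> lebesgue_on (A \<times> B) \<rightarrow>\<^sub>M Y"
    by simp
  show m: "(\<lambda>x. x) \<in> lebesgue_on (A \<times> B) \<rightarrow>\<^sub>M lebesgue_on A \<Otimes>\<^sub>M Y"
    using measurable_Pair[OF 1 2] by simp
  show "distr (lebesgue_on (A \<times> B)) (lebesgue_on A \<Otimes>\<^sub>M Y) (\<lambda>x. x) = lebesgue_on A \<Otimes>\<^sub>M Y"
  proof (rule pair_measure_eqI[symmetric, OF sf(2,1)])
    fix E F assume E: "E \<in> sets (lebesgue_on A)" and F: "F \<in> sets Y"
    have E': "E \<subseteq> A" "E \<in> sets lebesgue"
      using E A sets_restrict_space_iff[of A lebesgue E] by auto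
    have F0: "F \<subseteq> B"
      using F sp sets.sets_into_space by blast
    have "F \<in> sets (lebesgue_on B)"
      using measurable_sets[OF id F] F0 by (simp add: Int_absorb2)
    then have F': "F \<in> sets lebesgue"
      using B sets_restrict_space_iff[of B lebesgue F] by auto
    \<comment> \<open>\<open>Y\<close> may have fewer measurable sets than
      \<open>lebesgue_on B\<close>; the hypothesis \<open>distr\<close> is what ties its values to
      Lebesgue measure.\<close>
    have "emeasure Y F = emeasure (lebesgue_on B) F"
      using F0 emeasure_distr[OF id F] by (simp add: distr Int_absorb2)
    also have "\<dots> = emeasure lebesgue F"
      using F0 B by (intro emeasure_restrict_space) auto
    finally have eF: "emeasure Y F = emeasure lebesgue F" .
    have eE: "emeasure (lebesgue_on A) E = emeasure lebesgue E"
      using E' A by (intro emeasure_restrict_space) auto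
    have "emeasure (distr (lebesgue_on (A \<times> B)) (lebesgue_on A \<Otimes>\<^sub>M Y) (\<lambda>x. x)) (E \<times> F)
        = emeasure (lebesgue_on (A \<times> B)) (E \<times> F)"
      using E F E' F0 by (subst emeasure_distr[OF m]) (auto intro!: arg_cong2[where f=emeasure])
    also have "\<dots> = emeasure lebesgue (E \<times> F)"
      using E' F0 lebesgue_sets_Times[OF A B] by (intro emeasure_restrict_space) auto
    finally show "emeasure (lebesgue_on A) E * emeasure Y F =
        emeasure (distr (lebesgue_on (A \<times> B)) (lebesgue_on A \<Otimes>\<^sub>M Y) (\<lambda>x. x)) (E \<times> F)"
      by (simp add: eE eF emeasure_lebesgue_Times E' F')
  qed simp
qed

section \<open>Sampling one point per piece\<close>

lemma nn_integral_pair4: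
  assumes "sigma_finite_measure M2" "sigma_finite_measure M3" "sigma_finite_measure M4"
    and [measurable]: "f \<in> borel_measurable (M1 \<Otimes>\<^sub>M (M2 \<Otimes>\<^sub>M (M3 \<Otimes>\<^sub>M M4)))"
  shows "(\<integral>\<^sup>+z. f z \<partial>(M1 \<Otimes>\<^sub>M (M2 \<Otimes>\<^sub>M (M3 \<Otimes>\<^sub>M M4)))) =
    (\<integral>\<^sup>+a. \<integral>\<^sup>+b. \<integral>\<^sup>+c. \<integral>\<^sup>+d. f (a, b, c, d) \<partial>M4 \<partial>M3 \<partial>M2 \<partial>M1)"
proof -
  interpret M2: sigma_finite_measure M2 by fact
  interpret M3: sigma_finite_measure M3 by fact
  interpret M4: sigma_finite_measure M4 by fact
  interpret p34: pair_sigma_finite M3 M4 ..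
  interpret p234: pair_sigma_finite M2 "M3 \<Otimes>\<^sub>M M4" ..
  show ?thesis
    apply (subst p234.nn_integral_fst[symmetric], measurable)
    apply (intro nn_integral_cong)
    apply (subst p34.nn_integral_fst[symmetric], measurable)
    apply (intro nn_integral_cong)
    apply (subst M4.nn_integral_fst[symmetric], measurable)
    done
qed

text \<open>Distinct coordinates are independent. They are split off \<open>K\<close> one at a time;
  the coordinates left over in \<open>L\<close> then integrate a constant over a probability
  space.\<close>

lemma nn_integral_PiM_distinct4:
  assumes N: "\<And>k. prob_space (N k)" and K: "finite K"
    and k: "{k1, k2, k3, k4} \<subseteq> K" "distinct [k1, k2, k3, k4]"
    and j: "j \<in> borel_measurable (N k1 \<Otimes>\<^sub>M (N k2 \<Otimes>\<^sub>M (N k3 \<Otimes>\<^sub>M N k4)))"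
  shows "(\<integral>\<^sup>+\<omega>. j (\<omega> k1, \<omega> k2, \<omega> k3, \<omega> k4) \<partial>PiM K N) =
    (\<integral>\<^sup>+z. j z \<partial>(N k1 \<Otimes>\<^sub>M (N k2 \<Otimes>\<^sub>M (N k3 \<Otimes>\<^sub>M N k4))))"
proof -
  note [measurable] = j
  interpret N: prob_space "N k" for k by (rule N)
  interpret product_sigma_finite N ..
  have [simp]: "k1 \<noteq> k2" "k1 \<noteq> k3" "k1 \<noteq> k4" "k2 \<noteq> k3" "k2 \<noteq> k4" "k3 \<noteq> k4"
    "k2 \<noteq> k1" "k3 \<noteq> k1" "k4 \<noteq> k1" "k3 \<noteq> k2" "k4 \<noteq> k2" "k4 \<noteq> k3"
    using k(2) by auto
  define L where "L = K - {k1, k2, k3, k4}"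
  have L: "finite L" "k1 \<notin> L" "k2 \<notin> L" "k3 \<notin> L" "k4 \<notin> L"
    using K by (auto simp: L_def)
  have KL: "K = insert k1 (insert k2 (insert k3 (insert k4 L)))"
    using k by (auto simp: L_def)
  interpret PL: prob_space "PiM L N"
    by (intro prob_space_PiM N)
  note [simp] = PL.emeasure_space_1
  have "(\<integral>\<^sup>+\<omega>. j (\<omega> k1, \<omega> k2, \<omega> k3, \<omega> k4) \<partial>PiM K N) =
      (\<integral>\<^sup>+a. \<integral>\<^sup>+b. \<integral>\<^sup>+c. \<integral>\<^sup>+d. j (a, b, c, d) \<partial>N k4 \<partial>N k3 \<partial>N k2 \<partial>N k1)"
    unfolding KL
    apply (subst product_nn_integral_insert_rev)
    using L apply simp_all [2]
     apply measurable
    apply (rule nn_integral_cong)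
    apply simp
    apply (subst product_nn_integral_insert_rev)
    using L apply simp_all [2]
     apply measurable
    apply (rule nn_integral_cong)
    apply simp
    apply (subst product_nn_integral_insert_rev)
    using L apply simp_all [2]
     apply measurable
    apply (rule nn_integral_cong)
    apply simp
    apply (subst product_nn_integral_insert_rev)
    using L apply simp_all [2]
     apply measurable
    done
  also have "\<dots> = (\<integral>\<^sup>+z. j z \<partial>(N k1 \<Otimes>\<^sub>M (N k2 \<Otimes>\<^sub>M (N k3 \<Otimes>\<^sub>M N k4))))"
    by (intro nn_integral_pair4[symmetric] j N.sigma_finite_measure_axioms)
  finally show ?thesis .
qed

text \<open>It is enough to compare rectangles, and there finiteness lets the quotient in
  \<open>ennreal\<close> split into two quotients.\<close>

lemma uniform_measure_pair:
  assumes "finite_measure A" "finite_measure B"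
    and S: "S \<in> sets A" "emeasure A S \<noteq> 0" and T: "T \<in> sets B" "emeasure B T \<noteq> 0"
  shows "uniform_measure A S \<Otimes>\<^sub>M uniform_measure B T = uniform_measure (A \<Otimes>\<^sub>M B) (S \<times> T)"
proof (rule pair_measure_eqI)
  interpret A: finite_measure A by fact
  interpret B: finite_measure B by fact
  show "sigma_finite_measure (uniform_measure A S)"
    using prob_space_uniform_measure[OF S(2)]
    by (intro prob_space_imp_sigma_finite) (simp add: A.emeasure_finite)
  show "sigma_finite_measure (uniform_measure B T)"
    using prob_space_uniform_measure[OF T(2)]
    by (intro prob_space_imp_sigma_finite) (simp add: B.emeasure_finite)
  show "sets (uniform_measure A S \<Otimes>\<^sub>M uniform_measure B T) = sets (uniform_measure (A \<Otimes>\<^sub>M B) (S \<times> T))"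
    by (simp cong: sets_pair_measure_cong)
  fix E F assume "E \<in> sets (uniform_measure A S)" "F \<in> sets (uniform_measure B T)"
  then have [measurable]: "E \<in> sets A" "F \<in> sets B" "S \<in> sets A" "T \<in> sets B" 
    using S T by auto
  have "emeasure (uniform_measure (A \<Otimes>\<^sub>M B) (S \<times> T)) (E \<times> F) =
      emeasure (A \<Otimes>\<^sub>M B) ((S \<inter> E) \<times> (T \<inter> F)) / emeasure (A \<Otimes>\<^sub>M B) (S \<times> T)"
    by (subst emeasure_uniform_measure) (auto simp: Times_Int_Times)
  then show "emeasure (uniform_measure A S) E * emeasure (uniform_measure B T) F =
      emeasure (uniform_measure (A \<Otimes>\<^sub>M B) (S \<times> T)) (E \<times> F)"
    by (simp add: B.emeasure_pair_measure_Times divide_ennreal_def ennreal_inverse_mult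
      A.emeasure_finite B.emeasure_finite less_top[symmetric] mult_ac)
qed

section \<open>Means over a probability space\<close>

context prob_space begin

lemma nn_integral_le_bound:
  assumes "\<And>x. x \<in> space M \<Longrightarrow> f x \<le> c"
  shows "(\<integral>\<^sup>+x. f x \<partial>M) \<le> c"
proof -
  have "(\<integral>\<^sup>+x. f x \<partial>M) \<le> (\<integral>\<^sup>+x. c \<partial>M)"
    by (rule nn_integral_mono) (rule assms)
  then show ?thesis by (simp add: emeasure_space_1)
qed

text \<open>If \<open>f\<close> exceeded \<open>c + e\<close> everywhere, its mean would be at least
  \<open>c + e\<close>, which is strictly larger than \<open>c\<close> because \<open>c\<close> is
  finite.\<close>

lemma exists_le_nn_integral:
  assumes "(\<integral>\<^sup>+x. f x \<partial>M) \<le> c" "c < \<infinity>" "0 < e"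
  shows "\<exists>x\<in>space M. f x \<le> c + e"
proof (rule ccontr)
  assume "\<not> ?thesis"
  then have "(\<integral>\<^sup>+x. c + e \<partial>M) \<le> (\<integral>\<^sup>+x. f x \<partial>M)"
    by (intro nn_integral_mono) auto
  also have "(\<integral>\<^sup>+x. c + e \<partial>M) = c + e"
    by (simp add: emeasure_space_1)
  finally have "c + e \<le> c"
    using assms(1) by (rule order.trans)
  moreover have "c < c + e"
    using assms(2,3) by simp
  ultimately show False by simp
qed

end

section \<open>Colliding pieces and the choice of a sample\<close>

abbreviation power4 :: "'a measure \<Rightarrow> ('a \<times> 'a \<times> 'a \<times> 'a) measure" where
  "power4 M \<equiv> M \<Otimes>\<^sub>M (M \<Otimes>\<^sub>M (M \<Otimes>\<^sub>M M))"

text \<open>Counts the coinciding pairs instead of testing for one: the count is at least 1 as soon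
  as two pieces agree, and its integral splits into six pair terms.\<close>

definition collision :: "('a \<Rightarrow> 'k) \<Rightarrow> 'a \<times> 'a \<times> 'a \<times> 'a \<Rightarrow> ennreal" where
  "collision \<kappa> = (\<lambda>(a, b, c, d).
     of_bool (\<kappa> a = \<kappa> b) + of_bool (\<kappa> a = \<kappa> c) + of_bool (\<kappa> a = \<kappa> d) +
     of_bool (\<kappa> b = \<kappa> c) + of_bool (\<kappa> b = \<kappa> d) + of_bool (\<kappa> c = \<kappa> d))"

text \<open>Since \<kappa> has finite range, \<open>g\<close> can be an arbitrary function. This
  yields measurability of everything that depends on points only through their parts or
  pieces.\<close>

lemma simple_function_map4:
  assumes "simple_function M \<kappa>"
  shows "simple_function (power4 M) (\<lambda>(a, b, c, d). g (\<kappa> a) (\<kappa> b) (\<kappa> c) (\<kappa> d))"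
proof -
  have "simple_function (power4 M) (\<lambda>x. \<kappa> (fst x))"
    "simple_function (power4 M) (\<lambda>x. \<kappa> (fst (snd x)))"
    "simple_function (power4 M) (\<lambda>x. \<kappa> (fst (snd (snd x))))"
    "simple_function (power4 M) (\<lambda>x. \<kappa> (snd (snd (snd x))))"
    by (rule simple_function_comp[OF _ assms], measurable)+
  then have "simple_function (power4 M)
      (\<lambda>x. (\<kappa> (fst x), \<kappa> (fst (snd x)), \<kappa> (fst (snd (snd x))), \<kappa> (snd (snd (snd x)))))"
    by (intro simple_function_Pair)
  from simple_function_compose1[OF this, of "\<lambda>(a, b, c, d). g a b c d"] show ?thesis
    by (simp add: split_def)
qed

context prob_space begin

text \<open>With one entry of the pair fixed, the integral over the other is the mass of a single
  fibre of \<kappa>; all other integrals are over probability measures.\<close>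

lemma power4_of_bool_le:
  assumes \<kappa>: "simple_function M \<kappa>"
    and atom: "\<And>k. emeasure M {x \<in> space M. \<kappa> x = k} \<le> \<epsilon>"
  shows "(\<integral>\<^sup>+(a, b, c, d). of_bool (\<kappa> a = \<kappa> b) \<partial>power4 M) \<le> \<epsilon>"
    "(\<integral>\<^sup>+(a, b, c, d). of_bool (\<kappa> a = \<kappa> c) \<partial>power4 M) \<le> \<epsilon>"
    "(\<integral>\<^sup>+(a, b, c, d). of_bool (\<kappa> a = \<kappa> d) \<partial>power4 M) \<le> \<epsilon>"
    "(\<integral>\<^sup>+(a, b, c, d). of_bool (\<kappa> b = \<kappa> c) \<partial>power4 M) \<le> \<epsilon>"
    "(\<integral>\<^sup>+(a, b, c, d). of_bool (\<kappa> b = \<kappa> d) \<partial>power4 M) \<le> \<epsilon>"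
    "(\<integral>\<^sup>+(a, b, c, d). of_bool (\<kappa> c = \<kappa> d) \<partial>power4 M) \<le> \<epsilon>"
proof -
  have one: "(\<integral>\<^sup>+y. of_bool (\<kappa> x = \<kappa> y) \<partial>M) \<le> \<epsilon>" for x
  proof -
    have "(\<integral>\<^sup>+y. of_bool (\<kappa> x = \<kappa> y) \<partial>M) = (\<integral>\<^sup>+y. indicator {y \<in> space M. \<kappa> y = \<kappa> x} y \<partial>M)"
      by (intro nn_integral_cong) auto
    also have "\<dots> = emeasure M {y \<in> space M. \<kappa> y = \<kappa> x}"
      using simple_functionD(2)[OF \<kappa>, of "{\<kappa> x}"]
      by (subst nn_integral_indicator) (auto simp: vimage_def Int_def conj_commute)
    finally show ?thesis using atom by simp
  qed
  note it = nn_integral_pair4[OF sigma_finite_measure_axioms sigma_finite_measure_axioms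
      sigma_finite_measure_axioms borel_measurable_simple_function[OF simple_function_map4[OF \<kappa>]]]
  note [simp] = emeasure_space_1
  show "(\<integral>\<^sup>+(a, b, c, d). of_bool (\<kappa> a = \<kappa> b) \<partial>power4 M) \<le> \<epsilon>"
    by (subst it[of "\<lambda>a b c d. of_bool (a = b)"], simp, intro nn_integral_le_bound one)
  show "(\<integral>\<^sup>+(a, b, c, d). of_bool (\<kappa> a = \<kappa> c) \<partial>power4 M) \<le> \<epsilon>"
    by (subst it[of "\<lambda>a b c d. of_bool (a = c)"], simp, intro nn_integral_le_bound one)
  show "(\<integral>\<^sup>+(a, b, c, d). of_bool (\<kappa> a = \<kappa> d) \<partial>power4 M) \<le> \<epsilon>"
    by (subst it[of "\<lambda>a b c d. of_bool (a = d)"], simp, intro nn_integral_le_bound one)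
  show "(\<integral>\<^sup>+(a, b, c, d). of_bool (\<kappa> b = \<kappa> c) \<partial>power4 M) \<le> \<epsilon>"
    by (subst it[of "\<lambda>a b c d. of_bool (b = c)"], simp, intro nn_integral_le_bound one)
  show "(\<integral>\<^sup>+(a, b, c, d). of_bool (\<kappa> b = \<kappa> d) \<partial>power4 M) \<le> \<epsilon>"
    by (subst it[of "\<lambda>a b c d. of_bool (b = d)"], simp, intro nn_integral_le_bound one)
  show "(\<integral>\<^sup>+(a, b, c, d). of_bool (\<kappa> c = \<kappa> d) \<partial>power4 M) \<le> \<epsilon>"
    by (subst it[of "\<lambda>a b c d. of_bool (c = d)"], simp, intro nn_integral_le_bound one)
qed

lemma nn_integral_collision_le:
  assumes \<kappa>: "simple_function M \<kappa>"
    and atom: "\<And>k. emeasure M {x \<in> space M. \<kappa> x = k} \<le> \<epsilon>"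
  shows "(\<integral>\<^sup>+x. collision \<kappa> x \<partial>power4 M) \<le> 6 * \<epsilon>"
proof -
  have add6: "(\<integral>\<^sup>+x. f1 x + f2 x + f3 x + f4 x + f5 x + f6 x \<partial>power4 M) =
      integral\<^sup>N (power4 M) f1 + integral\<^sup>N (power4 M) f2 + integral\<^sup>N (power4 M) f3 + integral\<^sup>N (power4 M) f4 + integral\<^sup>N (power4 M) f5 + integral\<^sup>N (power4 M) f6"
    if [measurable]: "f1 \<in> borel_measurable (power4 M)" "f2 \<in> borel_measurable (power4 M)" "f3 \<in> borel_measurable (power4 M)" "f4 \<in> borel_measurable (power4 M)" "f5 \<in> borel_measurable (power4 M)" "f6 \<in> borel_measurable (power4 M)"
    for f1 f2 f3 f4 f5 f6 :: "_ \<Rightarrow> ennreal"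
    by (simp add: nn_integral_add)
  have "(\<integral>\<^sup>+x. collision \<kappa> x \<partial>power4 M) =
     (\<integral>\<^sup>+x. (\<lambda>(a, b, c, d). of_bool (\<kappa> a = \<kappa> b)) x + (\<lambda>(a, b, c, d). of_bool (\<kappa> a = \<kappa> c)) x +
        (\<lambda>(a, b, c, d). of_bool (\<kappa> a = \<kappa> d)) x + (\<lambda>(a, b, c, d). of_bool (\<kappa> b = \<kappa> c)) x +
        (\<lambda>(a, b, c, d). of_bool (\<kappa> b = \<kappa> d)) x + (\<lambda>(a, b, c, d). of_bool (\<kappa> c = \<kappa> d)) x \<partial>power4 M)"
    by (intro nn_integral_cong) (simp add: collision_def split: prod.split)
  also have "\<dots> = (\<integral>\<^sup>+(a, b, c, d). of_bool (\<kappa> a = \<kappa> b) \<partial>power4 M) +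
     (\<integral>\<^sup>+(a, b, c, d). of_bool (\<kappa> a = \<kappa> c) \<partial>power4 M) +
     (\<integral>\<^sup>+(a, b, c, d). of_bool (\<kappa> a = \<kappa> d) \<partial>power4 M) +
     (\<integral>\<^sup>+(a, b, c, d). of_bool (\<kappa> b = \<kappa> c) \<partial>power4 M) +
     (\<integral>\<^sup>+(a, b, c, d). of_bool (\<kappa> b = \<kappa> d) \<partial>power4 M) +
     (\<integral>\<^sup>+(a, b, c, d). of_bool (\<kappa> c = \<kappa> d) \<partial>power4 M)"
    by (intro add6 borel_measurable_simple_function simple_function_map4 \<kappa>)
  also have "\<dots> \<le> \<epsilon> + \<epsilon> + \<epsilon> + \<epsilon> + \<epsilon> + \<epsilon>"
    by (intro add_mono power4_of_bool_le assms)
  also have "\<dots> = 6 * \<epsilon>"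
  proof -
    have "(6::ennreal) = 1 + 1 + 1 + 1 + 1 + 1"
      by simp
    then show ?thesis
      by (simp only: distrib_right mult_1)
  qed
  finally show ?thesis .
qed

text \<open>First moment method: \<omega> is drawn from the product of the laws \<open>N k\<close>
  over the finitely many pieces, and Fubini lets the expectation be taken first, at a fixed
  quadruple of points. Of the constant 7, six come from the pairs that may collide and one from
  choosing an outcome close to the mean.\<close>

lemma exists_sample:
  fixes \<kappa> :: "'a \<Rightarrow> 'k" and N :: "'k \<Rightarrow> 'a measure"
  assumes \<kappa>: "simple_function M \<kappa>"
    and atom: "\<And>k. emeasure M {x \<in> space M. \<kappa> x = k} \<le> \<epsilon>" and \<epsilon>: "0 < \<epsilon>" "\<epsilon> < \<infinity>"
    and N: "\<And>k. prob_space (N k)" "\<And>k. sets (N k) = sets M"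
    and j: "j \<in> borel_measurable (power4 M)" "\<And>x. x \<in> space (power4 M) \<Longrightarrow> j x \<le> 1"
    and F: "F \<in> borel_measurable (power4 M)" "\<And>x. x \<in> space (power4 M) \<Longrightarrow> F x \<le> 1"
  shows "\<exists>\<omega>. (\<forall>x\<in>space M. \<omega> (\<kappa> x) \<in> space M) \<and>
    (\<integral>\<^sup>+(a, b, c, d). F (a, b, c, d) * j (\<omega> (\<kappa> a), \<omega> (\<kappa> b), \<omega> (\<kappa> c), \<omega> (\<kappa> d)) \<partial>power4 M) \<le>
    (\<integral>\<^sup>+(a, b, c, d). F (a, b, c, d) *
        (\<integral>\<^sup>+z. j z \<partial>(N (\<kappa> a) \<Otimes>\<^sub>M (N (\<kappa> b) \<Otimes>\<^sub>M (N (\<kappa> c) \<Otimes>\<^sub>M N (\<kappa> d))))) \<partial>power4 M) + 7 * \<epsilon>"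
proof -
  note [measurable] = j(1) F(1)
  define K where "K = \<kappa> ` space M"
  have K: "finite K"
    using \<kappa> by (simp add: K_def simple_function_def)
  have [measurable]: "\<kappa> \<in> M \<rightarrow>\<^sub>M count_space K"
    using \<kappa> by (auto simp: K_def simple_function_def measurable_count_space_eq2)
  have spN: "space (N k) = space M" for k
    using N(2) by (rule sets_eq_imp_space_eq)
  let ?\<Omega> = "PiM K N"
  interpret O: prob_space ?\<Omega>
    by (intro prob_space_PiM N)
  interpret M2: pair_prob_space M M ..
  interpret M3: pair_prob_space M "M \<Otimes>\<^sub>M M" ..
  interpret M4: pair_prob_space M "M \<Otimes>\<^sub>M (M \<Otimes>\<^sub>M M)" ..
  interpret OM: pair_prob_space ?\<Omega> "power4 M" ..
  define J where "J = (\<lambda>(a, b, c, d).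
    \<integral>\<^sup>+z. j z \<partial>(N (\<kappa> a) \<Otimes>\<^sub>M (N (\<kappa> b) \<Otimes>\<^sub>M (N (\<kappa> c) \<Otimes>\<^sub>M N (\<kappa> d)))))"
  define h where "h = (\<lambda>\<omega> (a, b, c, d). F (a, b, c, d) * j (\<omega> (\<kappa> a), \<omega> (\<kappa> b), \<omega> (\<kappa> c), \<omega> (\<kappa> d)))"
  have [measurable]: "J \<in> borel_measurable (power4 M)"
    unfolding J_def
    by (rule borel_measurable_simple_function, rule simple_function_map4[OF \<kappa>, of "\<lambda>k1 k2 k3 k4.
      \<integral>\<^sup>+z. j z \<partial>(N k1 \<Otimes>\<^sub>M (N k2 \<Otimes>\<^sub>M (N k3 \<Otimes>\<^sub>M N k4)))"])
  have [measurable]: "collision \<kappa> \<in> borel_measurable (power4 M)"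
    unfolding collision_def
    by (rule borel_measurable_simple_function, rule simple_function_map4[OF \<kappa>, of "\<lambda>k1 k2 k3 k4.
      of_bool (k1 = k2) + of_bool (k1 = k3) + of_bool (k1 = k4) +
      of_bool (k2 = k3) + of_bool (k2 = k4) + of_bool (k3 = k4)"])
  have comp: "(\<lambda>\<omega>. \<omega> k) \<in> ?\<Omega> \<rightarrow>\<^sub>M M" if "k \<in> K" for k
    using measurable_component_singleton[OF that, of N] N(2) by (simp cong: measurable_cong_sets)
  \<comment> \<open>The coordinate of \<omega> that is read depends on the point, so the claim is
    reduced to each fixed index of the finite set \<open>K\<close>.\<close>
  have [measurable]: "(\<lambda>p. fst p (\<kappa> (g (snd p)))) \<in> ?\<Omega> \<Otimes>\<^sub>M power4 M \<rightarrow>\<^sub>M M"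
    if [measurable]: "g \<in> power4 M \<rightarrow>\<^sub>M M" for g
    by (rule measurable_compose_countable'[where I=K and f="\<lambda>k p. fst p k" and g="\<lambda>p. \<kappa> (g (snd p))"])
      (use comp K in \<open>auto intro: countable_finite\<close>)
  have h_meas: "case_prod h \<in> borel_measurable (?\<Omega> \<Otimes>\<^sub>M power4 M)"
    unfolding h_def case_prod_beta by measurable
  \<comment> \<open>For four distinct pieces independence gives exactly \<open>F x * J x\<close>;
    otherwise \<open>h\<close> is at most 1 and at least one pair is counted by
    \<open>collision\<close>.\<close>
  have point: "(\<integral>\<^sup>+\<omega>. h \<omega> x \<partial>?\<Omega>) \<le> F x * J x + collision \<kappa> x" if x: "x \<in> space (power4 M)" for x
  proof -
    obtain a b c d where abcd: "x = (a, b, c, d)" by (cases x)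
    with x have sp: "a \<in> space M" "b \<in> space M" "c \<in> space M" "d \<in> space M"
      by (auto simp: space_pair_measure)
    then have k: "{\<kappa> a, \<kappa> b, \<kappa> c, \<kappa> d} \<subseteq> K"
      by (auto simp: K_def)
    have \<omega>sp: "\<omega> k \<in> space M" if "\<omega> \<in> space ?\<Omega>" "k \<in> K" for \<omega> k
      using that spN by (auto simp: space_PiM)
    show ?thesis
    proof (cases "distinct [\<kappa> a, \<kappa> b, \<kappa> c, \<kappa> d]")
      case True
      have [measurable]: "(\<lambda>\<omega>. j (\<omega> (\<kappa> a), \<omega> (\<kappa> b), \<omega> (\<kappa> c), \<omega> (\<kappa> d))) \<in> borel_measurable ?\<Omega>"
        using comp[of "\<kappa> a"] comp[of "\<kappa> b"] comp[of "\<kappa> c"] comp[of "\<kappa> d"] k by simp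
      have "j \<in> borel_measurable (N (\<kappa> a) \<Otimes>\<^sub>M (N (\<kappa> b) \<Otimes>\<^sub>M (N (\<kappa> c) \<Otimes>\<^sub>M N (\<kappa> d))))"
        using j(1) N(2) by (simp cong: measurable_cong_sets sets_pair_measure_cong)
      then have "(\<integral>\<^sup>+\<omega>. h \<omega> x \<partial>?\<Omega>) = F x * J x"
        using nn_integral_PiM_distinct4[OF N(1) K k True, of j]
        by (simp add: h_def abcd J_def nn_integral_cmult)
      then show ?thesis by simp
    next
      case False
      have "(\<integral>\<^sup>+\<omega>. h \<omega> x \<partial>?\<Omega>) \<le> 1"
      proof (rule O.nn_integral_le_bound)
        fix \<omega> assume "\<omega> \<in> space ?\<Omega>"
        then have "(\<omega> (\<kappa> a), \<omega> (\<kappa> b), \<omega> (\<kappa> c), \<omega> (\<kappa> d)) \<in> space (power4 M)"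
          using k \<omega>sp by (simp add: space_pair_measure)
        from mult_mono[OF F(2)[OF x] j(2)[OF this]] show "h \<omega> x \<le> 1"
          by (simp add: h_def abcd)
      qed
      also have "1 \<le> collision \<kappa> x"
        using False by (auto simp: collision_def abcd add.assoc intro: add_increasing add_increasing2)
      finally show ?thesis by (simp add: add_increasing)
    qed
  qed
  have "(\<integral>\<^sup>+\<omega>. \<integral>\<^sup>+x. h \<omega> x \<partial>power4 M \<partial>?\<Omega>) = (\<integral>\<^sup>+x. \<integral>\<^sup>+\<omega>. h \<omega> x \<partial>?\<Omega> \<partial>power4 M)"
    using OM.Fubini'[OF h_meas] by simp
  also have "\<dots> \<le> (\<integral>\<^sup>+x. F x * J x + collision \<kappa> x \<partial>power4 M)"
    by (intro nn_integral_mono point)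
  also have "\<dots> = (\<integral>\<^sup>+x. F x * J x \<partial>power4 M) + (\<integral>\<^sup>+x. collision \<kappa> x \<partial>power4 M)"
    by (intro nn_integral_add) measurable
  also have "\<dots> \<le> (\<integral>\<^sup>+x. F x * J x \<partial>power4 M) + 6 * \<epsilon>"
    by (intro add_left_mono nn_integral_collision_le \<kappa> atom)
  finally have le: "(\<integral>\<^sup>+\<omega>. \<integral>\<^sup>+x. h \<omega> x \<partial>power4 M \<partial>?\<Omega>) \<le> (\<integral>\<^sup>+x. F x * J x \<partial>power4 M) + 6 * \<epsilon>" .
  \<comment> \<open>This bound serves only to make the mean finite, as required for picking an
    outcome close to it.\<close>
  have J1: "J x \<le> 1" for x
  proof -
    obtain a b c d where abcd: "x = (a, b, c, d)" by (cases x)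
    interpret Na: prob_space "N (\<kappa> a)" by (rule N)
    interpret Nb: prob_space "N (\<kappa> b)" by (rule N)
    interpret Nc: prob_space "N (\<kappa> c)" by (rule N)
    interpret Nd: prob_space "N (\<kappa> d)" by (rule N)
    interpret N2: pair_prob_space "N (\<kappa> c)" "N (\<kappa> d)" ..
    interpret N3: pair_prob_space "N (\<kappa> b)" "N (\<kappa> c) \<Otimes>\<^sub>M N (\<kappa> d)" ..
    interpret N4: pair_prob_space "N (\<kappa> a)" "N (\<kappa> b) \<Otimes>\<^sub>M (N (\<kappa> c) \<Otimes>\<^sub>M N (\<kappa> d))" ..
    show ?thesis
      unfolding J_def abcd prod.case
      by (intro N4.nn_integral_le_bound j(2)) (simp add: space_pair_measure spN)
  qed
  have "(\<integral>\<^sup>+x. F x * J x \<partial>power4 M) \<le> 1"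
    using mult_mono[OF F(2) J1] by (intro M4.nn_integral_le_bound) simp
  moreover have "6 * \<epsilon> < top"
    using \<epsilon>(2) by (simp add: ennreal_mult_less_top)
  ultimately have fin: "(\<integral>\<^sup>+x. F x * J x \<partial>power4 M) + 6 * \<epsilon> < \<infinity>"
    by (auto intro: order.strict_trans1)
  obtain \<omega> where \<omega>: "\<omega> \<in> space ?\<Omega>"
    "(\<integral>\<^sup>+x. h \<omega> x \<partial>power4 M) \<le> (\<integral>\<^sup>+x. F x * J x \<partial>power4 M) + 6 * \<epsilon> + \<epsilon>"
    using O.exists_le_nn_integral[OF le fin \<epsilon>(1)] by blast
  have seven: "6 * \<epsilon> + \<epsilon> = 7 * \<epsilon>"
    using distrib_right[of 6 1 \<epsilon>] by simp
  have eq: "(\<integral>\<^sup>+(a, b, c, d). F (a, b, c, d) *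
      (\<integral>\<^sup>+z. j z \<partial>(N (\<kappa> a) \<Otimes>\<^sub>M (N (\<kappa> b) \<Otimes>\<^sub>M (N (\<kappa> c) \<Otimes>\<^sub>M N (\<kappa> d))))) \<partial>power4 M) =
      (\<integral>\<^sup>+x. F x * J x \<partial>power4 M)"
    by (intro nn_integral_cong) (simp add: J_def split: prod.split)
  show ?thesis
  proof (intro exI[of _ \<omega>] conjI ballI)
    show "\<omega> (\<kappa> x) \<in> space M" if "x \<in> space M" for x
      using \<omega>(1) that spN by (auto simp: space_PiM K_def)
  next
    show "(\<integral>\<^sup>+(a, b, c, d). F (a, b, c, d) * j (\<omega> (\<kappa> a), \<omega> (\<kappa> b), \<omega> (\<kappa> c), \<omega> (\<kappa> d)) \<partial>power4 M) \<le>
      (\<integral>\<^sup>+(a, b, c, d). F (a, b, c, d) *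
        (\<integral>\<^sup>+z. j z \<partial>(N (\<kappa> a) \<Otimes>\<^sub>M (N (\<kappa> b) \<Otimes>\<^sub>M (N (\<kappa> c) \<Otimes>\<^sub>M N (\<kappa> d))))) \<partial>power4 M) + 7 * \<epsilon>"
      unfolding eq seven[symmetric] add.assoc[symmetric] by (rule \<omega>(2)[unfolded h_def])
  qed
qed

end

section \<open>Averaging over boxes\<close>

text \<open>Null sets get \<open>M\<close> itself, only to keep this a probability measure.\<close>

definition uniform_on :: "'a measure \<Rightarrow> 'a set \<Rightarrow> 'a measure" where
  "uniform_on M S = (if emeasure M S = 0 then M else uniform_measure M S)"

lemma sets_uniform_on [simp]: "sets (uniform_on M S) = sets M"
  by (simp add: uniform_on_def)

text \<open>The constant value of a step graphon on a box. If a side is null, the numerator vanishes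
  as well and 0 / 0 = 0 in \<open>ennreal\<close>, in agreement with the convention of
  \<open>step_graphon\<close>.\<close>

definition cell_average :: "'a measure \<Rightarrow> ('a \<times> 'a \<Rightarrow> ennreal) \<Rightarrow> 'a set \<Rightarrow> 'a set \<Rightarrow> ennreal" where
  "cell_average M w S T =
     (\<integral>\<^sup>+z. w z * indicator (S \<times> T) z \<partial>(M \<Otimes>\<^sub>M M)) / (emeasure M S * emeasure M T)"

section \<open>Integrals over boxes and self-adjointness of averaging\<close>

context prob_space begin

lemma prob_space_uniform_on: "prob_space (uniform_on M S)"
  unfolding uniform_on_def
  using prob_space_axioms prob_space_uniform_measure[of M S] by (auto simp: emeasure_finite)

lemma set_nn_integral_Times_null:
  assumes "S \<in> sets M" "T \<in> sets M" "emeasure M S = 0 \<or> emeasure M T = 0"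
  shows "(\<integral>\<^sup>+z. w z * indicator (S \<times> T) z \<partial>(M \<Otimes>\<^sub>M M)) = 0"
  using assms by (intro nn_integral_null_set) (auto simp: null_sets_def emeasure_pair_measure_Times)

lemma cell_average_le_1:
  assumes "S \<in> sets M" "T \<in> sets M" "\<And>z. w z \<le> 1"
  shows "cell_average M w S T \<le> 1"
proof (cases "emeasure M S = 0 \<or> emeasure M T = 0")
  case True
  then show ?thesis
    using set_nn_integral_Times_null[OF assms(1,2)] by (simp add: cell_average_def)
next
  case False
  have "(\<integral>\<^sup>+z. w z * indicator (S \<times> T) z \<partial>(M \<Otimes>\<^sub>M M)) \<le> (\<integral>\<^sup>+z. indicator (S \<times> T) z \<partial>(M \<Otimes>\<^sub>M M))"
    using assms(3) by (intro nn_integral_mono) (auto split: split_indicator)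
  also have "\<dots> = emeasure M S * emeasure M T"
    using assms by (simp add: emeasure_pair_measure_Times)
  finally show ?thesis
    using False unfolding cell_average_def
    by (intro divide_le_posI_ennreal) (auto simp: zero_less_iff_neq_zero)
qed

text \<open>The factors for the two edges share no variable, so Fubini separates them.\<close>

lemma nn_integral_box_split:
  assumes [measurable]: "w \<in> borel_measurable (M \<Otimes>\<^sub>M M)"
    and [measurable]: "S1 \<in> sets M" "S2 \<in> sets M" "S3 \<in> sets M" "S4 \<in> sets M"
  shows "(\<integral>\<^sup>+x. (case x of (a, b, c, d) \<Rightarrow> w (a, b) * w (c, d)) * indicator (S1 \<times> S2 \<times> S3 \<times> S4) x \<partial>power4 M) =
    (\<integral>\<^sup>+z. w z * indicator (S1 \<times> S2) z \<partial>(M \<Otimes>\<^sub>M M)) *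
    (\<integral>\<^sup>+z. w z * indicator (S3 \<times> S4) z \<partial>(M \<Otimes>\<^sub>M M))"
proof -
  let ?A = "\<integral>\<^sup>+z. w z * indicator (S3 \<times> S4) z \<partial>(M \<Otimes>\<^sub>M M)"
  have "(\<integral>\<^sup>+x. (case x of (a, b, c, d) \<Rightarrow> w (a, b) * w (c, d)) * indicator (S1 \<times> S2 \<times> S3 \<times> S4) x \<partial>power4 M) =
     (\<integral>\<^sup>+a. \<integral>\<^sup>+b. \<integral>\<^sup>+c. \<integral>\<^sup>+d. (w (a, b) * indicator (S1 \<times> S2) (a, b)) *
        (w (c, d) * indicator (S3 \<times> S4) (c, d)) \<partial>M \<partial>M \<partial>M \<partial>M)"
    by (subst nn_integral_pair4[OF sigma_finite_measure_axioms sigma_finite_measure_axioms sigma_finite_measure_axioms])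
      (measurable, auto intro!: nn_integral_cong split: split_indicator)
  also have "\<dots> = (\<integral>\<^sup>+a. \<integral>\<^sup>+b. (w (a, b) * indicator (S1 \<times> S2) (a, b)) * ?A \<partial>M \<partial>M)"
  proof (intro nn_integral_cong)
    fix a b assume "a \<in> space M" "b \<in> space M"
    let ?k = "w (a, b) * indicator (S1 \<times> S2) (a, b)"
    have "(\<integral>\<^sup>+c. \<integral>\<^sup>+d. ?k * (w (c, d) * indicator (S3 \<times> S4) (c, d)) \<partial>M \<partial>M) =
        (\<integral>\<^sup>+z. ?k * (w z * indicator (S3 \<times> S4) z) \<partial>(M \<Otimes>\<^sub>M M))"
      by (subst nn_integral_fst[symmetric]) auto
    also have "\<dots> = ?k * ?A"
      by (intro nn_integral_cmult) measurable
    finally show "(\<integral>\<^sup>+c. \<integral>\<^sup>+d. ?k * (w (c, d) * indicator (S3 \<times> S4) (c, d)) \<partial>M \<partial>M) = ?k * ?A" .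
  qed
  also have "\<dots> = (\<integral>\<^sup>+z. w z * indicator (S1 \<times> S2) z * ?A \<partial>(M \<Otimes>\<^sub>M M))"
    by (subst nn_integral_fst[symmetric]) auto
  also have "\<dots> = (\<integral>\<^sup>+z. w z * indicator (S1 \<times> S2) z \<partial>(M \<Otimes>\<^sub>M M)) * ?A"
    by (intro nn_integral_multc) measurable
  finally show ?thesis .
qed

text \<open>By \<open>uniform_measure_pair\<close>, applied three times, the product of the four
  laws is uniform on the box. Positive sides keep \<open>uniform_on\<close> out of its default
  branch.\<close>

lemma nn_integral_uniform_on_box:
  assumes [measurable]: "j \<in> borel_measurable (power4 M)"
    and S: "S1 \<in> sets M" "S2 \<in> sets M" "S3 \<in> sets M" "S4 \<in> sets M"
    and nz: "emeasure M S1 \<noteq> 0" "emeasure M S2 \<noteq> 0" "emeasure M S3 \<noteq> 0" "emeasure M S4 \<noteq> 0"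
  shows "(\<integral>\<^sup>+z. j z \<partial>(uniform_on M S1 \<Otimes>\<^sub>M (uniform_on M S2 \<Otimes>\<^sub>M (uniform_on M S3 \<Otimes>\<^sub>M uniform_on M S4)))) =
    (\<integral>\<^sup>+z. j z * indicator (S1 \<times> S2 \<times> S3 \<times> S4) z \<partial>power4 M) /
    (emeasure M S1 * (emeasure M S2 * (emeasure M S3 * emeasure M S4)))"
proof -
  note [measurable] = S
  interpret M2: pair_prob_space M M ..
  interpret M3: pair_prob_space M "M \<Otimes>\<^sub>M M" ..
  have e2: "emeasure (M \<Otimes>\<^sub>M M) (S3 \<times> S4) = emeasure M S3 * emeasure M S4"
    by (simp add: emeasure_pair_measure_Times)
  have e3: "emeasure (M \<Otimes>\<^sub>M (M \<Otimes>\<^sub>M M)) (S2 \<times> S3 \<times> S4) = emeasure M S2 * (emeasure M S3 * emeasure M S4)"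
    by (simp add: M2.emeasure_pair_measure_Times e2)
  have e4: "emeasure (power4 M) (S1 \<times> S2 \<times> S3 \<times> S4) =
      emeasure M S1 * (emeasure M S2 * (emeasure M S3 * emeasure M S4))"
    by (simp add: M3.emeasure_pair_measure_Times e3)
  have "uniform_on M S1 \<Otimes>\<^sub>M (uniform_on M S2 \<Otimes>\<^sub>M (uniform_on M S3 \<Otimes>\<^sub>M uniform_on M S4)) =
      uniform_measure (power4 M) (S1 \<times> S2 \<times> S3 \<times> S4)"
    using nz by (simp add: uniform_on_def uniform_measure_pair S finite_measure_axioms
        M2.P.finite_measure_axioms M3.P.finite_measure_axioms e2 e3)
  then show ?thesis
    by (simp add: nn_integral_uniform_measure e4)
qed

text \<open>The factor built from \<open>G\<close> is constant on boxes, hence a finite sum of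
  multiples of box indicators. The formula is used in both directions to prove self-adjointness,
  once with the weights as \<open>F\<close> and once with the kernel.\<close>

lemma nn_integral_partition_boxes:
  fixes G :: "'a set \<Rightarrow> 'a set \<Rightarrow> 'a set \<Rightarrow> 'a set \<Rightarrow> ennreal"
  assumes P: "finite P" "disjoint P" "P \<subseteq> sets M"
    and \<pi>: "\<And>x. x \<in> space M \<Longrightarrow> \<pi> x \<in> P \<and> x \<in> \<pi> x"
    and [measurable]: "F \<in> borel_measurable (power4 M)"
  shows "(\<integral>\<^sup>+x. F x * (case x of (a, b, c, d) \<Rightarrow> G (\<pi> a) (\<pi> b) (\<pi> c) (\<pi> d)) \<partial>power4 M) =
    (\<Sum>(S1, S2, S3, S4)\<in>P \<times> P \<times> P \<times> P. G S1 S2 S3 S4 * (\<integral>\<^sup>+x. F x * indicator (S1 \<times> S2 \<times> S3 \<times> S4) x \<partial>power4 M))"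
proof -
  \<comment> \<open>Disjointness makes \<open>\<pi> x\<close> the only part containing
    \<open>x\<close>, so each point lies in exactly one box and the sum below has a single nonzero
    summand at most.\<close>
  have mem: "x \<in> S \<longleftrightarrow> S = \<pi> x" if "x \<in> space M" "S \<in> P" for x S
    using \<pi>[OF that(1)] that(2) P(2) by (auto simp: disjoint_def)
  have [measurable]: "S1 \<times> S2 \<times> S3 \<times> S4 \<in> sets (power4 M)" if "S1 \<in> P" "S2 \<in> P" "S3 \<in> P" "S4 \<in> P" for S1 S2 S3 S4
    using that P(3) by (intro pair_measureI) auto
  have "F x * (case x of (a, b, c, d) \<Rightarrow> G (\<pi> a) (\<pi> b) (\<pi> c) (\<pi> d)) =
      (\<Sum>s\<in>P \<times> P \<times> P \<times> P. case s of (S1, S2, S3, S4) \<Rightarrow> G S1 S2 S3 S4 * (F x * indicator (S1 \<times> S2 \<times> S3 \<times> S4) x))"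
    if x: "x \<in> space (power4 M)" for x
  proof -
    obtain a b c d where abcd: "x = (a, b, c, d)" by (cases x)
    with x have sp: "a \<in> space M" "b \<in> space M" "c \<in> space M" "d \<in> space M"
      by (auto simp: space_pair_measure)
    have "(\<Sum>s\<in>P \<times> P \<times> P \<times> P. case s of (S1, S2, S3, S4) \<Rightarrow> G S1 S2 S3 S4 * (F x * indicator (S1 \<times> S2 \<times> S3 \<times> S4) x)) =
        (\<Sum>s\<in>P \<times> P \<times> P \<times> P. if s = (\<pi> a, \<pi> b, \<pi> c, \<pi> d) then G (\<pi> a) (\<pi> b) (\<pi> c) (\<pi> d) * F x else 0)"
    proof (intro sum.cong refl)
      fix s assume "s \<in> P \<times> P \<times> P \<times> P"
      then obtain S1 S2 S3 S4 where s: "s = (S1, S2, S3, S4)"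
        and S: "S1 \<in> P" "S2 \<in> P" "S3 \<in> P" "S4 \<in> P"
        by auto
      have "x \<in> S1 \<times> S2 \<times> S3 \<times> S4 \<longleftrightarrow> s = (\<pi> a, \<pi> b, \<pi> c, \<pi> d)"
        unfolding abcd s mem_Sigma_iff mem[OF sp(1) S(1)] mem[OF sp(2) S(2)]
          mem[OF sp(3) S(3)] mem[OF sp(4) S(4)] prod.inject by (rule refl)
      then show "(case s of (S1, S2, S3, S4) \<Rightarrow> G S1 S2 S3 S4 * (F x * indicator (S1 \<times> S2 \<times> S3 \<times> S4) x)) =
          (if s = (\<pi> a, \<pi> b, \<pi> c, \<pi> d) then G (\<pi> a) (\<pi> b) (\<pi> c) (\<pi> d) * F x else 0)"
        by (simp add: s indicator_def)
    qed
    also have "\<dots> = G (\<pi> a) (\<pi> b) (\<pi> c) (\<pi> d) * F x"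
      using P(1) \<pi> sp by (subst sum.delta) auto
    finally show ?thesis by (simp add: abcd mult.commute)
  qed
  then have "(\<integral>\<^sup>+x. F x * (case x of (a, b, c, d) \<Rightarrow> G (\<pi> a) (\<pi> b) (\<pi> c) (\<pi> d)) \<partial>power4 M) =
     (\<integral>\<^sup>+x. (\<Sum>s\<in>P \<times> P \<times> P \<times> P. case s of (S1, S2, S3, S4) \<Rightarrow>
        G S1 S2 S3 S4 * (F x * indicator (S1 \<times> S2 \<times> S3 \<times> S4) x)) \<partial>power4 M)"
    by (intro nn_integral_cong) auto
  also have "\<dots> = (\<Sum>s\<in>P \<times> P \<times> P \<times> P. \<integral>\<^sup>+x. (case s of (S1, S2, S3, S4) \<Rightarrow>
        G S1 S2 S3 S4 * (F x * indicator (S1 \<times> S2 \<times> S3 \<times> S4) x)) \<partial>power4 M)"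
    by (intro nn_integral_sum) auto
  also have "\<dots> = (\<Sum>(S1, S2, S3, S4)\<in>P \<times> P \<times> P \<times> P.
      G S1 S2 S3 S4 * (\<integral>\<^sup>+x. F x * indicator (S1 \<times> S2 \<times> S3 \<times> S4) x \<partial>power4 M))"
    by (intro sum.cong) (auto simp: nn_integral_cmult)
  finally show ?thesis .
qed

text \<open>After expansion over boxes, each side contributes the integral of the weights times the
  integral of \<open>j\<close>, divided by the four measures of the sides.\<close>

lemma nn_integral_averaging_adjoint:
  assumes P: "finite P" "disjoint P" "P \<subseteq> sets M"
    and \<pi>: "\<And>x. x \<in> space M \<Longrightarrow> \<pi> x \<in> P \<and> x \<in> \<pi> x"
    and j [measurable]: "j \<in> borel_measurable (power4 M)"
    and w [measurable]: "w \<in> borel_measurable (M \<Otimes>\<^sub>M M)"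
  shows "(\<integral>\<^sup>+(a, b, c, d). w (a, b) * w (c, d) *
      (\<integral>\<^sup>+z. j z \<partial>(uniform_on M (\<pi> a) \<Otimes>\<^sub>M (uniform_on M (\<pi> b) \<Otimes>\<^sub>M
        (uniform_on M (\<pi> c) \<Otimes>\<^sub>M uniform_on M (\<pi> d))))) \<partial>power4 M) =
    (\<integral>\<^sup>+(a, b, c, d). cell_average M w (\<pi> a) (\<pi> b) * cell_average M w (\<pi> c) (\<pi> d) *
      j (a, b, c, d) \<partial>power4 M)"
proof -
  let ?w = "\<lambda>(a, b, c, d). w (a, b) * w (c, d)"
  let ?J = "\<lambda>S1 S2 S3 S4. \<integral>\<^sup>+z. j z \<partial>(uniform_on M S1 \<Otimes>\<^sub>M (uniform_on M S2 \<Otimes>\<^sub>M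
        (uniform_on M S3 \<Otimes>\<^sub>M uniform_on M S4)))"
  let ?V = "\<lambda>S1 S2 S3 S4. cell_average M w S1 S2 * cell_average M w S3 S4"
  let ?I = "\<lambda>F S1 S2 S3 S4. \<integral>\<^sup>+x. F x * indicator (S1 \<times> S2 \<times> S3 \<times> S4) x \<partial>power4 M"
  have cell: "?J S1 S2 S3 S4 * ?I ?w S1 S2 S3 S4 = ?V S1 S2 S3 S4 * ?I j S1 S2 S3 S4"
    if "S1 \<in> P" "S2 \<in> P" "S3 \<in> P" "S4 \<in> P" for S1 S2 S3 S4
  proof -
    have S [measurable]: "S1 \<in> sets M" "S2 \<in> sets M" "S3 \<in> sets M" "S4 \<in> sets M"
      using that P(3) by auto
    let ?a = "\<lambda>S T. \<integral>\<^sup>+z. w z * indicator (S \<times> T) z \<partial>(M \<Otimes>\<^sub>M M)"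
    show ?thesis
    proof (cases "emeasure M S1 = 0 \<or> emeasure M S2 = 0 \<or> emeasure M S3 = 0 \<or> emeasure M S4 = 0")
      \<comment> \<open>On a null box the average of \<open>j\<close> has an arbitrary default
        value, but it is multiplied by an integral of \<open>w\<close> that vanishes, and so does
        one of the two cell averages.\<close>
      case True
      then have "?a S1 S2 = 0 \<or> ?a S3 S4 = 0"
        using set_nn_integral_Times_null S by blast
      then show ?thesis
        by (auto simp: nn_integral_box_split[OF w S] cell_average_def)
    next
      case False
      then show ?thesis
        unfolding nn_integral_box_split[OF w S] cell_average_def
        by (simp add: nn_integral_uniform_on_box[OF j S] divide_ennreal_def ennreal_inverse_mult emeasure_finite
            less_top[symmetric] ennreal_mult_eq_top_iff mult_ac)
    qed
  qed
  have "(\<integral>\<^sup>+(a, b, c, d). w (a, b) * w (c, d) * ?J (\<pi> a) (\<pi> b) (\<pi> c) (\<pi> d) \<partial>power4 M) =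
     (\<integral>\<^sup>+x. ?w x * (case x of (a, b, c, d) \<Rightarrow> ?J (\<pi> a) (\<pi> b) (\<pi> c) (\<pi> d)) \<partial>power4 M)"
    by (intro nn_integral_cong) auto
  also have "\<dots> = (\<Sum>(S1, S2, S3, S4)\<in>P \<times> P \<times> P \<times> P. ?J S1 S2 S3 S4 * ?I ?w S1 S2 S3 S4)"
    by (rule nn_integral_partition_boxes[OF P \<pi>]) auto
  also have "\<dots> = (\<Sum>(S1, S2, S3, S4)\<in>P \<times> P \<times> P \<times> P. ?V S1 S2 S3 S4 * ?I j S1 S2 S3 S4)"
    using cell by (intro sum.cong) auto
  also have "\<dots> = (\<integral>\<^sup>+x. j x * (case x of (a, b, c, d) \<Rightarrow> ?V (\<pi> a) (\<pi> b) (\<pi> c) (\<pi> d)) \<partial>power4 M)"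
    by (rule nn_integral_partition_boxes[OF P \<pi>, symmetric]) auto
  also have "\<dots> = (\<integral>\<^sup>+(a, b, c, d). ?V (\<pi> a) (\<pi> b) (\<pi> c) (\<pi> d) * j (a, b, c, d) \<partial>power4 M)"
    by (intro nn_integral_cong) (auto simp: mult.commute)
  finally show ?thesis .
qed

end

section \<open>The unit cube\<close>

abbreviation unit_measure :: "real measure" where
  "unit_measure \<equiv> lebesgue_on {0..1}"

interpretation unit: prob_space unit_measure
  by standard (simp add: emeasure_restrict_space)

lemma unit_square_transfer:
  "(\<lambda>x. x) \<in> lebesgue_on ({0..1} \<times> {0..1}) \<rightarrow>\<^sub>M unit_measure \<Otimes>\<^sub>M unit_measure"
  "distr (lebesgue_on ({0..1} \<times> {0..1})) (unit_measure \<Otimes>\<^sub>M unit_measure) (\<lambda>x. x) =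
    unit_measure \<Otimes>\<^sub>M unit_measure"
  by (rule lebesgue_on_Times; simp add: unit.sigma_finite_measure_axioms distr_id)+

text \<open>Starting from \<open>unit_square_transfer\<close>, one factor at a time is added on the
  left, with the product obtained so far in the role of \<open>Y\<close>.\<close>

lemma unit_cube4_transfer:
  "(\<lambda>x. x) \<in> lebesgue_on unit_cube4 \<rightarrow>\<^sub>M power4 unit_measure"
  "distr (lebesgue_on unit_cube4) (power4 unit_measure) (\<lambda>x. x) = power4 unit_measure"
proof -
  interpret U2: pair_prob_space unit_measure unit_measure ..
  interpret U3: pair_prob_space unit_measure "unit_measure \<Otimes>\<^sub>M unit_measure" ..
  have s2: "{0..1::real} \<times> {0..1::real} \<in> sets lebesgue"
    by (intro lebesgue_sets_Times) auto
  have s3: "{0..1::real} \<times> {0..1::real} \<times> {0..1::real} \<in> sets lebesgue"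
    by (intro lebesgue_sets_Times) auto
  note t3 = lebesgue_on_Times[OF _ s2 unit_square_transfer U2.P.sigma_finite_measure_axioms
      unit.sigma_finite_measure_axioms]
  have t3': "(\<lambda>x. x) \<in> lebesgue_on ({0..1} \<times> {0..1} \<times> {0..1}) \<rightarrow>\<^sub>M unit_measure \<Otimes>\<^sub>M (unit_measure \<Otimes>\<^sub>M unit_measure)"
    "distr (lebesgue_on ({0..1} \<times> {0..1} \<times> {0..1})) (unit_measure \<Otimes>\<^sub>M (unit_measure \<Otimes>\<^sub>M unit_measure)) (\<lambda>x. x) =
      unit_measure \<Otimes>\<^sub>M (unit_measure \<Otimes>\<^sub>M unit_measure)"
    by (rule t3; simp add: space_pair_measure)+
  note t4 = lebesgue_on_Times[OF _ s3 t3' U3.P.sigma_finite_measure_axioms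
      unit.sigma_finite_measure_axioms]
  show "(\<lambda>x. x) \<in> lebesgue_on unit_cube4 \<rightarrow>\<^sub>M power4 unit_measure"
    "distr (lebesgue_on unit_cube4) (power4 unit_measure) (\<lambda>x. x) = power4 unit_measure"
    by (rule t4; simp add: space_pair_measure)+
qed

text \<open>The change of measure applies to integrands measurable in the smaller, product
  sigma-algebra. Hence the passage to Borel versions of \<open>W\<close> and of the kernels.\<close>

lemma nn_integral_unit_square:
  assumes "f \<in> borel_measurable (unit_measure \<Otimes>\<^sub>M unit_measure)"
  shows "(\<integral>\<^sup>+x. f x \<partial>lebesgue_on ({0..1} \<times> {0..1})) = (\<integral>\<^sup>+x. f x \<partial>(unit_measure \<Otimes>\<^sub>M unit_measure))"
  using nn_integral_distr[OF unit_square_transfer(1), of f] assms by (simp add: unit_square_transfer(2))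

lemma nn_integral_unit_cube4:
  assumes "f \<in> borel_measurable (power4 unit_measure)"
  shows "(\<integral>\<^sup>+x. f x \<partial>lebesgue_on unit_cube4) = (\<integral>\<^sup>+x. f x \<partial>power4 unit_measure)"
  using nn_integral_distr[OF unit_cube4_transfer(1), of f] assms by (simp add: unit_cube4_transfer(2))

lemma unit_cube4_borel [simp, measurable]: "unit_cube4 \<in> sets borel"
  by (intro borel_Times) auto

lemma prob_space_unit_cube4: "prob_space (lebesgue_on unit_cube4)"
proof
  interpret U2: pair_prob_space unit_measure unit_measure ..
  interpret U3: pair_prob_space unit_measure "unit_measure \<Otimes>\<^sub>M unit_measure" ..
  interpret U4: pair_prob_space unit_measure "unit_measure \<Otimes>\<^sub>M (unit_measure \<Otimes>\<^sub>M unit_measure)" ..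
  show "emeasure (lebesgue_on unit_cube4) (space (lebesgue_on unit_cube4)) = 1"
    using nn_integral_unit_cube4[of "\<lambda>_. 1"] U4.emeasure_space_1 by simp
qed

section \<open>Borel representatives of Lebesgue measurable functions\<close>

lemma measurable_pair_to_borel:
  assumes [measurable]: "(\<lambda>x. x) \<in> A \<rightarrow>\<^sub>M (borel :: 'a::second_countable_topology measure)"
    "(\<lambda>x. x) \<in> B \<rightarrow>\<^sub>M (borel :: 'b::second_countable_topology measure)"
  shows "(\<lambda>x. x) \<in> A \<Otimes>\<^sub>M B \<rightarrow>\<^sub>M borel"
proof -
  have "fst \<in> A \<Otimes>\<^sub>M B \<rightarrow>\<^sub>M (borel :: 'a measure)" "snd \<in> A \<Otimes>\<^sub>M B \<rightarrow>\<^sub>M (borel :: 'b measure)"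
    using measurable_compose[OF measurable_fst assms(1)] measurable_compose[OF measurable_snd assms(2)] by auto
  from borel_measurable_Pair[OF this] show ?thesis by simp
qed

lemma unit_measure_to_borel: "(\<lambda>x. x) \<in> unit_measure \<rightarrow>\<^sub>M borel"
  by (intro measurable_restrict_space1 measurable_completion) simp

lemma borel_measurable_unit_square:
  "f \<in> borel_measurable borel \<Longrightarrow> f \<in> borel_measurable (unit_measure \<Otimes>\<^sub>M unit_measure)"
  by (rule measurable_compose[OF measurable_pair_to_borel, of _ _ f, simplified])
    (intro unit_measure_to_borel)+

lemma borel_measurable_unit_cube4:
  "f \<in> borel_measurable borel \<Longrightarrow> f \<in> borel_measurable (power4 unit_measure)"
  by (rule measurable_compose[OF measurable_pair_to_borel, of _ _ f, simplified])
    (intro unit_measure_to_borel measurable_pair_to_borel)+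

text \<open>Extend by 0 outside \<open>S\<close> and use that a completion adds functions only up to
  null sets. The exceptional set is returned explicitly so that a majorant can be defined on
  it.\<close>

lemma lebesgue_on_borel_version:
  fixes h :: "'a::euclidean_space \<Rightarrow> real"
  assumes "S \<in> sets lebesgue" "h \<in> borel_measurable (lebesgue_on S)"
  obtains h' N where "h' \<in> borel_measurable borel" "N \<in> null_sets lborel" "\<And>x. x \<in> S - N \<Longrightarrow> h x = h' x"
proof -
  have "(\<lambda>x. if x \<in> S then h x else 0) \<in> borel_measurable lebesgue"
    using assms by (simp add: borel_measurable_if)
  from completion_ex_borel_measurable_real[OF this]
  obtain h' where h': "h' \<in> borel_measurable lborel" "AE x in lborel. (if x \<in> S then h x else 0) = h' x"
    by blast
  from h'(2) obtain N where "N \<in> null_sets lborel" "{x. (if x \<in> S then h x else 0) \<noteq> h' x} \<subseteq> N"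
    by (auto simp: eventually_ae_filter)
  note N = this
  show ?thesis
  proof (rule that[OF _ N(1)])
    show "h' \<in> borel_measurable borel"
      using h'(1) by simp
    show "h x = h' x" if "x \<in> S - N" for x
      using that N(2) by (auto dest: subsetD[of _ _ x])
  qed
qed

text \<open>Tuples nest to the right, so the first two entries are not a component of the pair.
  Hence the detour over sections: for almost every \<open>x\<close> the condition concerns
  \<open>fst y\<close> alone, and Fubini reassembles the sections.\<close>

lemma AE_lborel_pair12:
  fixes N :: "('a::euclidean_space \<times> 'b::euclidean_space) set"
  assumes "N \<in> null_sets lborel"
  shows "AE z in (lborel :: ('a \<times> 'b \<times> 'c::euclidean_space) measure). (fst z, fst (snd z)) \<notin> N"
proof -
  have N [measurable]: "N \<in> sets borel"
    using assms by auto
  have "AE z in lborel \<Otimes>\<^sub>M lborel. z \<notin> N"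
    using assms by (subst lborel_prod) (rule AE_not_in)
  from lborel_pair.AE_pair[OF this] have "AE x in lborel. AE y in lborel. (x, y) \<notin> N" .
  then have "AE x in lborel. AE y in (lborel :: ('b \<times> 'c) measure). (x, fst y) \<notin> N"
    by eventually_elim (rule AE_lborel_fst)
  then have "AE z in lborel \<Otimes>\<^sub>M (lborel :: ('b \<times> 'c) measure). (fst z, fst (snd z)) \<notin> N"
    by (intro lborel_pair.AE_pair_measure)
      (auto simp: lborel_prod borel_prod[symmetric] intro!: measurable_sets_borel)
  then show ?thesis
    unfolding lborel_prod .
qed

lemma AE_unit_cube4_fst_snd:
  assumes "N \<in> null_sets lborel"
  shows "AE x in lebesgue_on unit_cube4. case x of (a, b, c, d) \<Rightarrow> (a, b) \<notin> N \<and> (c, d) \<notin> N"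
proof -
  have 1: "AE x :: real \<times> real \<times> real \<times> real in lborel. (fst x, fst (snd x)) \<notin> N"
    by (rule AE_lborel_pair12[OF assms])
  have 2: "AE x :: real \<times> real \<times> real \<times> real in lborel. snd (snd x) \<notin> N"
    by (intro AE_lborel_snd AE_not_in assms)
  from AE_completion[OF 1] AE_completion[OF 2]
  have "AE x in lebesgue. case x of (a, b, c, d) \<Rightarrow> (a, b) \<notin> N \<and> (c, d) \<notin> N"
    by eventually_elim auto
  then show ?thesis
    by (subst AE_restrict_space_iff) auto
qed

text \<open>A majorant, rather than a mere a.e. equal version: a sampled point may fall into the
  exceptional null set.\<close>

lemma upper_borel_version:
  assumes "(\<lambda>(a, b, c, d). J a b c d) \<in> borel_measurable (lebesgue_on unit_cube4)"
    and "\<And>a b c d. 0 \<le> J a b c d \<and> J a b c d \<le> (1::real)"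
  obtains j where "j \<in> borel_measurable (power4 unit_measure)" "\<And>x. j x \<le> (1::ennreal)"
    "\<And>a b c d. (a, b, c, d) \<in> unit_cube4 \<Longrightarrow> ennreal (J a b c d) \<le> j (a, b, c, d)"
    "AE x in lebesgue_on unit_cube4. j x = (case x of (a, b, c, d) \<Rightarrow> ennreal (J a b c d))"
proof -
  obtain h N where h [measurable]: "h \<in> borel_measurable borel" and N: "N \<in> null_sets lborel"
    and eq: "\<And>x. x \<in> unit_cube4 - N \<Longrightarrow> (case x of (a, b, c, d) \<Rightarrow> J a b c d) = h x"
    using lebesgue_on_borel_version[OF _ assms(1)] by (metis sets_completionI_sets unit_cube4_borel sets_lborel)
  have [measurable]: "N \<in> sets borel" using N by auto
  \<comment> \<open>The value 1 on \<open>N\<close> dominates every admissible kernel; the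
    truncation enforces the bound where \<open>h\<close> is not tied to \<open>J\<close>, that is,
    outside the cube.\<close>
  define j where "j x = (if x \<in> N then 1 else min 1 (ennreal (h x)))" for x
  have val: "j (a, b, c, d) = ennreal (J a b c d)" if "(a, b, c, d) \<in> unit_cube4 - N" for a b c d
    using eq[OF that] that assms(2)[of a b c d] by (auto simp: j_def min_def)
  show ?thesis
  proof (rule that[of j])
    have "j \<in> borel_measurable borel"
      unfolding j_def by measurable
    then show "j \<in> borel_measurable (power4 unit_measure)"
      by (rule borel_measurable_unit_cube4)
    show "j x \<le> 1" for x by (simp add: j_def)
    show "ennreal (J a b c d) \<le> j (a, b, c, d)" if "(a, b, c, d) \<in> unit_cube4" for a b c d
      using val[of a b c d] that assms(2)[of a b c d] by (cases "(a, b, c, d) \<in> N") (auto simp: j_def)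
    have "AE x in lebesgue. x \<notin> N"
      using N by (intro AE_completion AE_not_in)
    then show "AE x in lebesgue_on unit_cube4. j x = (case x of (a, b, c, d) \<Rightarrow> ennreal (J a b c d))"
      by (subst AE_restrict_space_iff) (auto simp: val elim!: eventually_mono)
  qed
qed

lemma measurable_unit_cube4_coords:
  "fst \<in> lebesgue_on unit_cube4 \<rightarrow>\<^sub>M unit_measure"
  "(\<lambda>x. fst (snd x)) \<in> lebesgue_on unit_cube4 \<rightarrow>\<^sub>M unit_measure"
  "(\<lambda>x. fst (snd (snd x))) \<in> lebesgue_on unit_cube4 \<rightarrow>\<^sub>M unit_measure"
  "(\<lambda>x. snd (snd (snd x))) \<in> lebesgue_on unit_cube4 \<rightarrow>\<^sub>M unit_measure"
proof -
  have 4: "(\<lambda>x. x) \<in> lebesgue_on unit_cube4 \<rightarrow>\<^sub>M power4 unit_measure"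
    by (rule unit_cube4_transfer)
  show "fst \<in> lebesgue_on unit_cube4 \<rightarrow>\<^sub>M unit_measure"
    "(\<lambda>x. fst (snd x)) \<in> lebesgue_on unit_cube4 \<rightarrow>\<^sub>M unit_measure"
    "(\<lambda>x. fst (snd (snd x))) \<in> lebesgue_on unit_cube4 \<rightarrow>\<^sub>M unit_measure"
    "(\<lambda>x. snd (snd (snd x))) \<in> lebesgue_on unit_cube4 \<rightarrow>\<^sub>M unit_measure"
    by (rule measurable_compose[OF 4], measurable)+
qed

lemma simple_function_unit_cube4:
  assumes "simple_function unit_measure \<kappa>"
  shows "simple_function (lebesgue_on unit_cube4) (\<lambda>(a, b, c, d). g (\<kappa> a) (\<kappa> b) (\<kappa> c) (\<kappa> d))"
  using simple_function_comp[OF unit_cube4_transfer(1) simple_function_map4[OF assms]] .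

section \<open>Pulling back a crossing kernel\<close>

lemma part_of_partition:
  assumes "partition_on A P" "x \<in> A"
  shows "part_of P x \<in> P" "x \<in> part_of P x"
proof -
  obtain S where S: "S \<in> P" "x \<in> S"
    using assms by (auto simp: partition_on_def)
  have "part_of P x = S"
    unfolding part_of_def
    using S assms(1) by (intro the_equality) (auto simp: partition_on_def disjoint_def)
  with S show "part_of P x \<in> P" "x \<in> part_of P x" by auto
qed

lemma part_of_eq:
  assumes "partition_on A P" "S \<in> P" "x \<in> S"
  shows "part_of P x = S"
  unfolding part_of_def
  using assms by (intro the_equality) (auto simp: partition_on_def disjoint_def)

locale partitioned_graphon =
  fixes W :: "real \<Rightarrow> real \<Rightarrow> real" and P :: "real set set"
  assumes graphon: "graphon W"
    and finite_P: "finite P" and partition: "partition_on {0..1} P"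
    and meas_P: "\<forall>S\<in>P. S \<in> sets lebesgue"
begin

lemma P_sub: "S \<in> P \<Longrightarrow> S \<subseteq> {0..1}"
  using partition by (auto simp: partition_on_def)

lemma P_sets: "S \<in> P \<Longrightarrow> S \<in> sets unit_measure"
  using meas_P P_sub by (auto simp: sets_restrict_space_iff)

text \<open>The fibres of \<open>part_of P\<close> over the unit interval are the parts
  themselves.\<close>

lemma simple_function_part_of: "simple_function unit_measure (part_of P)"
  unfolding simple_function_def
proof (intro conjI ballI)
  show "finite (part_of P ` space unit_measure)"
    using part_of_partition(1)[OF partition] by (intro finite_subset[OF _ finite_P]) auto
next
  fix S assume "S \<in> part_of P ` space unit_measure"
  then have S: "S \<in> P"
    using part_of_partition(1)[OF partition] by auto
  have "x \<in> {0..1} \<and> part_of P x = S \<longleftrightarrow> x \<in> S" for x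
    using part_of_partition(2)[OF partition, of x] part_of_eq[OF partition S, of x] P_sub[OF S] by blast
  then have "part_of P -` {S} \<inter> space unit_measure = S"
    by (simp add: vimage_def Int_def conj_commute)
  then show "part_of P -` {S} \<inter> space unit_measure \<in> sets unit_measure"
    using P_sets[OF S] by simp
qed

lemma W_bounds: "x \<in> {0..1} \<Longrightarrow> y \<in> {0..1} \<Longrightarrow> 0 \<le> W x y \<and> W x y \<le> 1"
  using graphon by (simp add: graphon_def)

text \<open>An almost everywhere equal version is enough here, in contrast to the kernels, because
  \<open>W\<close> is never evaluated at sampled points.\<close>

lemma borel_version_W:
  obtains w N where "w \<in> borel_measurable (unit_measure \<Otimes>\<^sub>M unit_measure)" "\<And>z. w z \<le> (1::ennreal)"
    "N \<in> null_sets lborel" 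
    "\<And>x y. x \<in> {0..1} \<Longrightarrow> y \<in> {0..1} \<Longrightarrow> (x, y) \<notin> N \<Longrightarrow> ennreal (W x y) = w (x, y)"
proof -
  have "{0..1::real} \<times> {0..1::real} \<in> sets lebesgue"
    by (intro lebesgue_sets_Times) auto
  moreover have "(\<lambda>(x, y). W x y) \<in> borel_measurable (lebesgue_on ({0..1} \<times> {0..1}))"
    using graphon by (simp add: graphon_def)
  ultimately obtain h N where h [measurable]: "h \<in> borel_measurable borel" and N: "N \<in> null_sets lborel"
    and eq: "\<And>z. z \<in> {0..1} \<times> {0..1} - N \<Longrightarrow> (case z of (x, y) \<Rightarrow> W x y) = h z"
    by (rule lebesgue_on_borel_version) blast
  show ?thesis
  proof (rule that[of "\<lambda>z. min 1 (ennreal (h z))" N])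
    show "(\<lambda>z. min 1 (ennreal (h z))) \<in> borel_measurable (unit_measure \<Otimes>\<^sub>M unit_measure)"
      by (intro borel_measurable_unit_square) measurable
    show "ennreal (W x y) = min 1 (ennreal (h (x, y)))"
      if "x \<in> {0..1}" "y \<in> {0..1}" "(x, y) \<notin> N" for x y
      using eq[of "(x, y)"] W_bounds[of x y] that by (simp add: min_def)
  qed (use N in auto)
qed

text \<open>Averages ignore the null set \<open>N\<close>, so equality holds at every point of the
  square and not merely almost everywhere.\<close>

lemma step_graphon_eq_cell_average:
  assumes w [measurable]: "w \<in> borel_measurable (unit_measure \<Otimes>\<^sub>M unit_measure)" and w1: "\<And>z. w z \<le> 1"
    and N: "N \<in> null_sets lborel"
    and eq: "\<And>x y. x \<in> {0..1} \<Longrightarrow> y \<in> {0..1} \<Longrightarrow> (x, y) \<notin> N \<Longrightarrow> ennreal (W x y) = w (x, y)"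
    and xy: "x \<in> {0..1}" "y \<in> {0..1}"
  shows "ennreal (step_graphon P W x y) = cell_average unit_measure w (part_of P x) (part_of P y)"
    and "0 \<le> step_graphon P W x y" and "step_graphon P W x y \<le> 1"
proof -
  define S T where "S = part_of P x" and "T = part_of P y"
  have ST: "S \<in> P" "T \<in> P"
    using part_of_partition[OF partition] xy by (auto simp: S_def T_def)
  note [measurable] = P_sets[OF ST(1)] P_sets[OF ST(2)]
  have sub: "S \<times> T \<subseteq> {0..1} \<times> {0..1}"
    using P_sub ST by blast
  have ST_leb: "S \<times> T \<in> sets lebesgue" and sq_leb: "{0..1::real} \<times> {0..1::real} \<in> sets lebesgue"
    using ST meas_P by (auto intro!: lebesgue_sets_Times)
  let ?A = "\<integral>\<^sup>+z. w z * indicator (S \<times> T) z \<partial>(unit_measure \<Otimes>\<^sub>M unit_measure)"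
  have em: "emeasure unit_measure S = ennreal (measure lebesgue S)" if "S \<in> P" for S
    using that meas_P P_sub unit.emeasure_eq_measure
    by (simp add: measure_restrict_space)
  have int: "(\<integral>(u, v). W u v \<partial>lebesgue_on (S \<times> T)) = enn2real ?A"
  proof -
    have "(\<lambda>(u, v). W u v) \<in> borel_measurable (lebesgue_on (S \<times> T))"
      using graphon sub measurable_restrict_mono unfolding graphon_def by blast
    moreover have "AE z in lebesgue_on (S \<times> T). 0 \<le> (case z of (u, v) \<Rightarrow> W u v)"
      using W_bounds sub by (intro AE_I2) (auto simp: space_restrict_space)
    ultimately have "(\<integral>(u, v). W u v \<partial>lebesgue_on (S \<times> T)) =
        enn2real (\<integral>\<^sup>+z. ennreal (case z of (u, v) \<Rightarrow> W u v) \<partial>lebesgue_on (S \<times> T))"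
      by (rule integral_eq_nn_integral)
    also have "(\<integral>\<^sup>+z. ennreal (case z of (u, v) \<Rightarrow> W u v) \<partial>lebesgue_on (S \<times> T)) =
        (\<integral>\<^sup>+z. ennreal (case z of (u, v) \<Rightarrow> W u v) * indicator (S \<times> T) z \<partial>lebesgue)"
      using ST_leb by (subst nn_integral_restrict_space) auto
    \<comment> \<open>The extra indicator of the square equals 1 on \<open>S \<times> T\<close>. It
      prepares the passage to Lebesgue measure on the square and from there to the product
      measure.\<close>
    also have "\<dots> = (\<integral>\<^sup>+z. (w z * indicator (S \<times> T) z) * indicator ({0..1} \<times> {0..1}) z \<partial>lebesgue)"
    proof (rule nn_integral_cong_AE)
      have "AE z in lebesgue. z \<notin> N"
        using N by (intro AE_completion AE_not_in)
      then show "AE z in lebesgue. ennreal (case z of (u, v) \<Rightarrow> W u v) * indicator (S \<times> T) z =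
          (w z * indicator (S \<times> T) z) * indicator ({0..1} \<times> {0..1}) z"
        by eventually_elim (use sub in \<open>auto simp: eq split: split_indicator\<close>)
    qed
    also have "\<dots> = (\<integral>\<^sup>+z. w z * indicator (S \<times> T) z \<partial>lebesgue_on ({0..1} \<times> {0..1}))"
      using sq_leb by (subst nn_integral_restrict_space) auto
    also have "\<dots> = ?A"
      by (intro nn_integral_unit_square) measurable
    finally show ?thesis .
  qed
  \<comment> \<open>Finiteness of \<open>?A\<close> is what allows \<open>enn2real\<close> to be
    undone below.\<close>
  have "?A \<le> (\<integral>\<^sup>+z. indicator (S \<times> T) z \<partial>(unit_measure \<Otimes>\<^sub>M unit_measure))"
    using w1 by (intro nn_integral_mono) (auto split: split_indicator)
  also have "\<dots> = emeasure unit_measure S * emeasure unit_measure T"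
    by (simp add: unit.emeasure_pair_measure_Times)
  also have "\<dots> < top"
    by (simp add: em ST ennreal_mult_less_top)
  finally have A_fin: "?A < top" .
  show 1: "ennreal (step_graphon P W x y) = cell_average unit_measure w (part_of P x) (part_of P y)"
  proof (cases "measure lebesgue S = 0 \<or> measure lebesgue T = 0")
    case True
    then have "?A = 0"
      using ST by (intro unit.set_nn_integral_Times_null) (auto simp: em)
    then show ?thesis
      using True by (auto simp: step_graphon_def cell_average_def S_def[symmetric] T_def[symmetric])
  next
    case False
    then have pos: "0 < measure lebesgue S * measure lebesgue T"
      by (simp add: zero_less_mult_iff zero_less_measure_iff)
    have "step_graphon P W x y = enn2real ?A / (measure lebesgue S * measure lebesgue T)"
      by (simp add: step_graphon_def int S_def[symmetric] T_def[symmetric])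
    also have "ennreal \<dots> = ennreal (enn2real ?A) / ennreal (measure lebesgue S * measure lebesgue T)"
      using pos by (intro divide_ennreal[symmetric]) auto
    also have "\<dots> = cell_average unit_measure w S T"
      using A_fin ST by (simp add: cell_average_def em ennreal_mult)
    finally show ?thesis
      by (simp add: S_def T_def)
  qed
  show 0: "0 \<le> step_graphon P W x y"
    unfolding step_graphon_def S_def[symmetric] T_def[symmetric] int by simp
  have "ennreal (step_graphon P W x y) \<le> 1"
    unfolding 1 using P_sets ST by (intro unit.cell_average_le_1 w1) (auto simp: S_def T_def)
  then show "step_graphon P W x y \<le> 1"
    by simp
qed

text \<open>A piece is the intersection of a part with an interval of length \<open>1 / n\<close>,
  which bounds its measure whatever the part is.\<close>

lemma cell_map:
  assumes "0 < (n::nat)"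
  defines "\<kappa> \<equiv> \<lambda>x. (part_of P x, \<lfloor>real n * x\<rfloor>)"
  shows "simple_function unit_measure \<kappa>"
    and "emeasure unit_measure {x \<in> space unit_measure. \<kappa> x = k} \<le> ennreal (1 / n)"
proof -
  have "simple_function unit_measure (\<lambda>x. \<lfloor>real n * x\<rfloor>)"
    unfolding simple_function_def
  proof (intro conjI ballI)
    \<comment> \<open>There are \<open>n + 1\<close> possible values: the last one,
      \<open>n\<close>, is attained only at \<open>x = 1\<close>.\<close>
    have "\<lfloor>real n * x\<rfloor> \<in> {0..int n}" if "x \<in> {0..1}" for x
    proof -
      have "real n * x \<le> real n * 1"
        using that by (intro mult_left_mono) auto
      then have "\<lfloor>real n * x\<rfloor> \<le> \<lfloor>real n\<rfloor>"
        by (intro floor_mono) simp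
      then show ?thesis using that by simp
    qed
    moreover have "space unit_measure = {0..1}"
      by simp
    ultimately have "(\<lambda>x. \<lfloor>real n * x\<rfloor>) ` space unit_measure \<subseteq> {0..int n}"
      by (intro image_subsetI) (simp only:)
    then show "finite ((\<lambda>x. \<lfloor>real n * x\<rfloor>) ` space unit_measure)"
      by (rule finite_subset) simp
    fix z assume "z \<in> (\<lambda>x. \<lfloor>real n * x\<rfloor>) ` space unit_measure"
    have [measurable]: "(\<lambda>x. x) \<in> unit_measure \<rightarrow>\<^sub>M borel"
      by (rule unit_measure_to_borel)
    have "(\<lambda>x. \<lfloor>real n * x\<rfloor>) \<in> unit_measure \<rightarrow>\<^sub>M count_space UNIV"
      by measurable
    then show "(\<lambda>x. \<lfloor>real n * x\<rfloor>) -` {z} \<inter> space unit_measure \<in> sets unit_measure"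
      by (rule measurable_sets) simp
  qed
  then show "simple_function unit_measure \<kappa>"
    unfolding \<kappa>_def by (intro simple_function_Pair simple_function_part_of)
  let ?I = "{snd k / real n .. (snd k + 1) / real n}"
  have sub: "{x \<in> space unit_measure. \<kappa> x = k} \<subseteq> ?I \<inter> {0..1}"
  proof
    fix x assume "x \<in> {x \<in> space unit_measure. \<kappa> x = k}"
    then have x: "x \<in> {0..1}" "\<lfloor>real n * x\<rfloor> = snd k"
      by (auto simp: \<kappa>_def)
    from x(2) have "snd k \<le> real n * x" "real n * x \<le> snd k + 1"
      by linarith+
    then show "x \<in> ?I \<inter> {0..1}"
      using x(1) assms(1) by (simp add: field_simps)
  qed
  have "emeasure unit_measure {x \<in> space unit_measure. \<kappa> x = k} \<le> emeasure unit_measure (?I \<inter> {0..1})"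
    using sub by (intro emeasure_mono) (auto simp: sets_restrict_space_iff)
  also have "\<dots> = emeasure lebesgue (?I \<inter> {0..1})"
    by (intro emeasure_restrict_space) auto
  also have "\<dots> \<le> emeasure lebesgue ?I"
    by (intro emeasure_mono) auto
  also have "\<dots> = ennreal (1 / n)"
    using assms(1) by (simp add: diff_divide_distrib[symmetric] field_simps)
  finally show "emeasure unit_measure {x \<in> space unit_measure. \<kappa> x = k} \<le> ennreal (1 / n)" .
qed

end

section \<open>Comparison of the two crossing integrals\<close>

context partitioned_graphon begin

lemma step_graphon_cube_measurable:
  "(\<lambda>(a, b, c, d). step_graphon P W a b * step_graphon P W c d) \<in> borel_measurable (lebesgue_on unit_cube4)"
  unfolding step_graphon_def
  by (intro borel_measurable_simple_function
      simple_function_unit_cube4[OF simple_function_part_of, of "\<lambda>S1 S2 S3 S4.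
        1 / (measure lebesgue S1 * measure lebesgue S2) * (\<integral>(u, v). W u v \<partial>lebesgue_on (S1 \<times> S2)) *
        (1 / (measure lebesgue S3 * measure lebesgue S4) * (\<integral>(u, v). W u v \<partial>lebesgue_on (S3 \<times> S4)))"])

text \<open>Here the sampled map is \<phi> = \<omega> \<circ> \<kappa>. Sampling bounds the
  pulled-back integral by one with the kernel averaged over boxes; self-adjointness then moves the
  averaging onto the weights, where it produces \<open>step_graphon P W\<close>.\<close>

lemma crossing_integral_pullback_le:
  assumes J: "(\<lambda>(a, b, c, d). J a b c d) \<in> borel_measurable (lebesgue_on unit_cube4)"
    and J01: "\<And>a b c d. 0 \<le> J a b c d \<and> J a b c d \<le> 1"
    and n: "0 < (n::nat)"
  shows "\<exists>\<phi>. simple_function unit_measure \<phi> \<and> (\<forall>x\<in>{0..1}. \<phi> x \<in> {0..1}) \<and>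
    crossing_integral W (\<lambda>a b c d. J (\<phi> a) (\<phi> b) (\<phi> c) (\<phi> d)) \<le>
    crossing_integral (step_graphon P W) J + 1 / n"
proof -
  obtain w N where w [measurable]: "w \<in> borel_measurable (unit_measure \<Otimes>\<^sub>M unit_measure)"
    and w1: "\<And>z. w z \<le> 1" and N: "N \<in> null_sets lborel"
    and weq: "\<And>x y. x \<in> {0..1} \<Longrightarrow> y \<in> {0..1} \<Longrightarrow> (x, y) \<notin> N \<Longrightarrow> ennreal (W x y) = w (x, y)"
    by (rule borel_version_W) blast
  obtain j where j [measurable]: "j \<in> borel_measurable (power4 unit_measure)" and j1: "\<And>x. j x \<le> 1"
    and j_ge: "\<And>a b c d. (a, b, c, d) \<in> unit_cube4 \<Longrightarrow> ennreal (J a b c d) \<le> j (a, b, c, d)"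
    and j_AE: "AE x in lebesgue_on unit_cube4. j x = (case x of (a, b, c, d) \<Rightarrow> ennreal (J a b c d))"
    by (rule upper_borel_version[OF J J01]) blast
  define \<kappa> where "\<kappa> = (\<lambda>x. (part_of P x, \<lfloor>real n * x\<rfloor>))"
  have \<kappa>: "simple_function unit_measure \<kappa>"
    "\<And>k. emeasure unit_measure {x \<in> space unit_measure. \<kappa> x = k} \<le> ennreal (1 / n)"
    using cell_map[OF n] by (auto simp: \<kappa>_def)
  have eps: "0 < ennreal (1 / n)" "ennreal (1 / n) < \<infinity>"
    using n by auto
  define F where "F = (\<lambda>(a, b, c, d). w (a, b) * w (c, d))"
  have F_meas: "F \<in> borel_measurable (power4 unit_measure)"
    unfolding F_def by measurable
  have F1: "F x \<le> 1" for x
    using mult_mono[OF w1 w1] by (simp add: F_def split: prod.split)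
  \<comment> \<open>The law depends only on the part \<open>fst k\<close>: pieces of one part get
    independent points, each uniform in the entire part and not in the piece.\<close>
  define unif where "unif = (\<lambda>k :: real set \<times> int. uniform_on unit_measure (fst k))"
  have u: "prob_space (unif k)" "sets (unif k) = sets unit_measure" for k
    using unit.prob_space_uniform_on by (auto simp: unif_def)
  have sp: "j x \<le> 1" "F x \<le> 1" if "x \<in> space (power4 unit_measure)" for x
    using j1 F1 by auto
  obtain \<omega> where \<omega>0: "\<forall>x\<in>space unit_measure. \<omega> (\<kappa> x) \<in> space unit_measure"
    and \<omega>_le: "(\<integral>\<^sup>+(a, b, c, d). F (a, b, c, d) * j (\<omega> (\<kappa> a), \<omega> (\<kappa> b), \<omega> (\<kappa> c), \<omega> (\<kappa> d)) \<partial>power4 unit_measure) \<le>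
      (\<integral>\<^sup>+(a, b, c, d). F (a, b, c, d) *
        (\<integral>\<^sup>+z. j z \<partial>(unif (\<kappa> a) \<Otimes>\<^sub>M (unif (\<kappa> b) \<Otimes>\<^sub>M (unif (\<kappa> c) \<Otimes>\<^sub>M unif (\<kappa> d))))) \<partial>power4 unit_measure) +
      7 * ennreal (1 / n)"
    using unit.exists_sample[where N=unif, OF \<kappa> eps u j sp(1) F_meas sp(2)] by blast
  have \<omega>: "\<omega> (\<kappa> x) \<in> {0..1}" if "x \<in> {0..1}" for x
    using \<omega>0 that by simp
  define \<phi> where "\<phi> x = \<omega> (\<kappa> x)" for x
  have \<phi>: "simple_function unit_measure \<phi>"
    unfolding \<phi>_def by (rule simple_function_compose1[OF \<kappa>(1)])
  have \<phi>01: "\<phi> x \<in> {0..1}" if "x \<in> {0..1}" for x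
    using \<omega>[OF that] by (simp add: \<phi>_def)
  define v where "v = (\<lambda>x y. step_graphon P W x y)"
  have v: "ennreal (v x y) = cell_average unit_measure w (part_of P x) (part_of P y)"
    "0 \<le> v x y" "v x y \<le> 1" if "x \<in> {0..1}" "y \<in> {0..1}" for x y
    using step_graphon_eq_cell_average[OF w w1 N weq that] by (auto simp: v_def)

  have avg: "(\<integral>\<^sup>+(a, b, c, d). F (a, b, c, d) *
        (\<integral>\<^sup>+z. j z \<partial>(unif (\<kappa> a) \<Otimes>\<^sub>M (unif (\<kappa> b) \<Otimes>\<^sub>M (unif (\<kappa> c) \<Otimes>\<^sub>M unif (\<kappa> d))))) \<partial>power4 unit_measure) =
      (\<integral>\<^sup>+(a, b, c, d). cell_average unit_measure w (part_of P a) (part_of P b) *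
        cell_average unit_measure w (part_of P c) (part_of P d) * j (a, b, c, d) \<partial>power4 unit_measure)"
    unfolding F_def unif_def \<kappa>_def prod.case fst_conv
    using P_sets part_of_partition[OF partition] partition_onD2[OF partition] finite_P
    by (intro unit.nn_integral_averaging_adjoint j w) auto
  \<comment> \<open>Back to Lebesgue measure on the cube before \<open>j\<close> is replaced by
    \<open>J\<close>, since \<open>J\<close> is only Lebesgue measurable and agrees with
    \<open>j\<close> only almost everywhere.\<close>
  also have "\<dots> = (\<integral>\<^sup>+(a, b, c, d). cell_average unit_measure w (part_of P a) (part_of P b) *
        cell_average unit_measure w (part_of P c) (part_of P d) * j (a, b, c, d) \<partial>lebesgue_on unit_cube4)"
  proof (rule nn_integral_unit_cube4[symmetric])
    have "(\<lambda>(a, b, c, d). cell_average unit_measure w (part_of P a) (part_of P b) *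
        cell_average unit_measure w (part_of P c) (part_of P d)) \<in> borel_measurable (power4 unit_measure)"
      by (intro borel_measurable_simple_function simple_function_map4[OF simple_function_part_of])
    from borel_measurable_times_ennreal[OF this j]
    show "(\<lambda>(a, b, c, d). cell_average unit_measure w (part_of P a) (part_of P b) *
        cell_average unit_measure w (part_of P c) (part_of P d) * j (a, b, c, d)) \<in> borel_measurable (power4 unit_measure)"
      by (simp add: split_def)
  qed
  also have "\<dots> = (\<integral>\<^sup>+x. ennreal (case x of (a, b, c, d) \<Rightarrow> v a b * v c d * J a b c d) \<partial>lebesgue_on unit_cube4)"
  proof (rule nn_integral_cong_AE)
    show "AE x in lebesgue_on unit_cube4. (case x of (a, b, c, d) \<Rightarrow>
        cell_average unit_measure w (part_of P a) (part_of P b) *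
        cell_average unit_measure w (part_of P c) (part_of P d) * j (a, b, c, d)) =
      ennreal (case x of (a, b, c, d) \<Rightarrow> v a b * v c d * J a b c d)"
      using j_AE AE_space
    proof eventually_elim
      fix x assume x: "j x = (case x of (a, b, c, d) \<Rightarrow> ennreal (J a b c d))"
        "x \<in> space (lebesgue_on unit_cube4)"
      obtain a b c d where abcd: "x = (a, b, c, d)" by (cases x)
      with x(2) have "a \<in> {0..1}" "b \<in> {0..1}" "c \<in> {0..1}" "d \<in> {0..1}"
        by auto
      then show "(case x of (a, b, c, d) \<Rightarrow>
          cell_average unit_measure w (part_of P a) (part_of P b) *
          cell_average unit_measure w (part_of P c) (part_of P d) * j (a, b, c, d)) =
        ennreal (case x of (a, b, c, d) \<Rightarrow> v a b * v c d * J a b c d)"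
        using x(1) J01[of a b c d] v[of a b] v[of c d] by (simp add: abcd ennreal_mult)
    qed
  qed
  also have "\<dots> = ennreal (8 * crossing_integral v J)"
  proof -
    interpret Q: prob_space "lebesgue_on unit_cube4"
      by (rule prob_space_unit_cube4)
    \<comment> \<open>A bounded measurable function on a probability space is integrable, so the
      Bochner integral in \<open>crossing_integral\<close> agrees with the nonnegative one.\<close>
    have bd: "AE x in lebesgue_on unit_cube4. (case x of (a, b, c, d) \<Rightarrow> v a b * v c d * J a b c d) \<in> {0..1}"
      using AE_space
    proof eventually_elim
      fix x assume x: "x \<in> space (lebesgue_on unit_cube4)"
      obtain a b c d where abcd: "x = (a, b, c, d)" by (cases x)
      with x have "a \<in> {0..1}" "b \<in> {0..1}" "c \<in> {0..1}" "d \<in> {0..1}"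
        by auto
      then show "(case x of (a, b, c, d) \<Rightarrow> v a b * v c d * J a b c d) \<in> {0..1}"
        using J01[of a b c d] v(2,3)[of a b] v(2,3)[of c d] by (simp add: abcd mult_le_one)
    qed
    have "(\<lambda>x. case x of (a, b, c, d) \<Rightarrow> v a b * v c d * J a b c d) \<in> borel_measurable (lebesgue_on unit_cube4)"
      using borel_measurable_times[OF step_graphon_cube_measurable J] by (simp add: v_def split_def)
    then have "integrable (lebesgue_on unit_cube4) (\<lambda>x. case x of (a, b, c, d) \<Rightarrow> v a b * v c d * J a b c d)"
    proof (rule Q.integrable_const_bound[rotated])
      show "AE x in lebesgue_on unit_cube4. norm (case x of (a, b, c, d) \<Rightarrow> v a b * v c d * J a b c d) \<le> 1"
        using bd by (rule eventually_mono) (simp only: atLeastAtMost_iff real_norm_def abs_of_nonneg)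
    qed
    from nn_integral_eq_integral[OF this] bd show ?thesis
      by (simp add: crossing_integral_def case_prod_unfold eventually_mono)
  qed
  finally have avg': "(\<integral>\<^sup>+(a, b, c, d). F (a, b, c, d) *
        (\<integral>\<^sup>+z. j z \<partial>(unif (\<kappa> a) \<Otimes>\<^sub>M (unif (\<kappa> b) \<Otimes>\<^sub>M (unif (\<kappa> c) \<Otimes>\<^sub>M unif (\<kappa> d))))) \<partial>power4 unit_measure) =
      ennreal (8 * crossing_integral v J)" .

  have v_nonneg: "0 \<le> crossing_integral v J"
  proof -
    have "0 \<le> (\<integral>(a, b, c, d). v a b * v c d * J a b c d \<partial>lebesgue_on unit_cube4)"
      using v(2) J01 by (intro integral_nonneg_AE AE_I2) auto
    then show ?thesis
      by (simp add: crossing_integral_def)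
  qed
  let ?f = "\<lambda>x. case x of (a, b, c, d) \<Rightarrow> W a b * W c d * J (\<phi> a) (\<phi> b) (\<phi> c) (\<phi> d)"
  \<comment> \<open>\<open>W\<close> is replaced by \<open>w\<close> off a null set of quadruples,
    while \<open>J\<close> at the sampled points is bounded by \<open>j_ge\<close>, which holds
    everywhere on the cube.\<close>
  have "(\<integral>\<^sup>+x. ennreal (?f x) \<partial>lebesgue_on unit_cube4) \<le>
      (\<integral>\<^sup>+(a, b, c, d). F (a, b, c, d) * j (\<phi> a, \<phi> b, \<phi> c, \<phi> d) \<partial>lebesgue_on unit_cube4)"
  proof (rule nn_integral_mono_AE)
    show "AE x in lebesgue_on unit_cube4. ennreal (?f x) \<le>
        (case x of (a, b, c, d) \<Rightarrow> F (a, b, c, d) * j (\<phi> a, \<phi> b, \<phi> c, \<phi> d))"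
      using AE_unit_cube4_fst_snd[OF N] AE_space
    proof eventually_elim
      fix x assume x: "case x of (a, b, c, d) \<Rightarrow> (a, b) \<notin> N \<and> (c, d) \<notin> N"
        "x \<in> space (lebesgue_on unit_cube4)"
      obtain a b c d where abcd: "x = (a, b, c, d)" by (cases x)
      with x(2) have *: "a \<in> {0..1}" "b \<in> {0..1}" "c \<in> {0..1}" "d \<in> {0..1}"
        by auto
      have "ennreal (?f x) = F x * ennreal (J (\<phi> a) (\<phi> b) (\<phi> c) (\<phi> d))"
        using x(1) J01[of "\<phi> a" "\<phi> b" "\<phi> c" "\<phi> d"] * W_bounds[of a b] W_bounds[of c d]
        by (simp add: abcd ennreal_mult weq F_def)
      also have "\<dots> \<le> F x * j (\<phi> a, \<phi> b, \<phi> c, \<phi> d)"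
        using * \<phi>01 by (intro mult_left_mono j_ge) auto
      finally show "ennreal (?f x) \<le> (case x of (a, b, c, d) \<Rightarrow> F (a, b, c, d) * j (\<phi> a, \<phi> b, \<phi> c, \<phi> d))"
        by (simp add: abcd)
    qed
  qed
  also have "\<dots> = (\<integral>\<^sup>+(a, b, c, d). F (a, b, c, d) * j (\<phi> a, \<phi> b, \<phi> c, \<phi> d) \<partial>power4 unit_measure)"
  proof (rule nn_integral_unit_cube4)
    \<comment> \<open>Measurability of the composite comes from the finite range of \<phi>, not from
      that of \<open>j\<close>.\<close>
    have "(\<lambda>(a, b, c, d). j (\<phi> a, \<phi> b, \<phi> c, \<phi> d)) \<in> borel_measurable (power4 unit_measure)"
      by (intro borel_measurable_simple_function simple_function_map4[OF \<phi>])
    from borel_measurable_times_ennreal[OF F_meas this]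
    show "(\<lambda>(a, b, c, d). F (a, b, c, d) * j (\<phi> a, \<phi> b, \<phi> c, \<phi> d)) \<in> borel_measurable (power4 unit_measure)"
      by (simp add: split_def)
  qed
  also have "\<dots> \<le> ennreal (8 * crossing_integral v J) + 7 * ennreal (1 / n)"
    using \<omega>_le unfolding avg' \<phi>_def .
  also have "\<dots> = ennreal (8 * crossing_integral v J + 7 / n)"
    using ennreal_mult[of 7 "1 / n"] v_nonneg by simp
  finally have le: "(\<integral>\<^sup>+x. ennreal (?f x) \<partial>lebesgue_on unit_cube4) \<le> ennreal (8 * crossing_integral v J + 7 / n)" .

  have nonneg: "0 \<le> 8 * crossing_integral v J + 7 / n"
    using v_nonneg by simp
  have "integral\<^sup>L (lebesgue_on unit_cube4) ?f \<le> 8 * crossing_integral v J + 7 / n"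
  proof (cases "integrable (lebesgue_on unit_cube4) ?f")
    case True
    have "AE x in lebesgue_on unit_cube4. 0 \<le> ?f x"
      using W_bounds J01 by (intro AE_I2) auto
    from nn_integral_eq_integral[OF True this] le nonneg show ?thesis
      by simp
  next
    \<comment> \<open>The Bochner integral then has its default value 0, and the bound is
      nonnegative.\<close>
    case False
    then show ?thesis
      using nonneg by (simp add: not_integrable_integral_eq)
  qed
  then have "crossing_integral W (\<lambda>a b c d. J (\<phi> a) (\<phi> b) (\<phi> c) (\<phi> d)) \<le> crossing_integral v J + 7 / n / 8"
    by (simp add: crossing_integral_def)
  \<comment> \<open>The 8 is the normalising factor of \<open>crossing_integral\<close>, the 7 the
    constant from \<open>exists_sample\<close>.\<close>
  also have "7 / n / 8 \<le> 1 / n"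
    using n by (simp add: field_simps)
  finally show ?thesis
    using \<phi> \<phi>01 by (intro exI[of _ \<phi>]) (auto simp: v_def)
qed

end

section \<open>Drawings\<close>

text \<open>Two segments meet iff their parametrisations agree for some \<open>s\<close> and
  \<open>t\<close> in the unit interval. The set is thus the projection of a closed set along a
  compact square.\<close>

lemma closed_segments_meet:
  "closed {p :: (real^2) \<times> (real^2) \<times> (real^2) \<times> (real^2).
    case p of (x, y, z, w) \<Rightarrow> convex hull {x, y} \<inter> convex hull {z, w} \<noteq> {}}"
proof -
  let ?g = "\<lambda>q :: (real \<times> real) \<times> (real^2) \<times> (real^2) \<times> (real^2) \<times> (real^2).
    case q of ((s, t), x, y, z, w) \<Rightarrow> (1 - s) *\<^sub>R x + s *\<^sub>R y - ((1 - t) *\<^sub>R z + t *\<^sub>R w)"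
  let ?T = "{q. fst q \<in> {0..1} \<times> {0..1} \<and> ?g q = 0}"
  have "continuous_on UNIV ?g"
    unfolding split_def by (intro continuous_intros)
  then have "closed (?g -` {0})"
    by (intro closed_vimage closed_singleton) (simp add: continuous_on_eq_continuous_at)
  moreover have "closed (fst -` ({0..1} \<times> {0..1}) :: ((real \<times> real) \<times> (real^2) \<times> (real^2) \<times> (real^2) \<times> (real^2)) set)"
    by (intro closed_vimage closed_Times closed_atLeastAtMost continuous_on_fst continuous_on_id)
  ultimately have "closed (fst -` ({0..1} \<times> {0..1}) \<inter> ?g -` {0})"
    by (intro closed_Int)
  then have "closed ?T"
    by (simp add: vimage_def Int_def)
  then have "closed {p. \<exists>st. st \<in> {0..1} \<times> {0..1} \<and> (st, p) \<in> ?T}"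
    by (intro closed_compact_projection compact_Times compact_Icc)
  also have "{p. \<exists>st. st \<in> {0..1} \<times> {0..1} \<and> (st, p) \<in> ?T} =
    {p. case p of (x, y, z, w) \<Rightarrow> convex hull {x, y} \<inter> convex hull {z, w} \<noteq> {}}"
    by (auto simp: segment_convex_hull[symmetric] closed_segment_def set_eq_iff)
  finally show ?thesis .
qed

lemma segments_meet_measurable:
  assumes "f \<in> borel_measurable unit_measure"
  shows "(\<lambda>(a, b, c, d). segments_meet (f a) (f b) (f c) (f d)) \<in> borel_measurable (lebesgue_on unit_cube4)"
proof -
  let ?C = "{p :: (real^2) \<times> (real^2) \<times> (real^2) \<times> (real^2).
    case p of (x, y, z, w) \<Rightarrow> convex hull {x, y} \<inter> convex hull {z, w} \<noteq> {}}"
  let ?f = "\<lambda>x. (f (fst x), f (fst (snd x)), f (fst (snd (snd x))), f (snd (snd (snd x))))"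
  have "?C \<in> sets borel"
    by (intro borel_closed closed_segments_meet)
  then have "indicat_real ?C \<in> borel_measurable borel"
    by (rule borel_measurable_indicator)
  moreover have "?f \<in> borel_measurable (lebesgue_on unit_cube4)"
    using measurable_unit_cube4_coords[THEN measurable_compose[OF _ assms]]
    by (intro borel_measurable_Pair)
  ultimately have "(\<lambda>x. indicat_real ?C (?f x)) \<in> borel_measurable (lebesgue_on unit_cube4)"
    by (rule measurable_compose[rotated])
  also have "(\<lambda>x. indicat_real ?C (?f x)) = (\<lambda>(a, b, c, d). segments_meet (f a) (f b) (f c) (f d))"
    by (auto simp: fun_eq_iff segments_meet_def indicator_def of_bool_def)
  finally show ?thesis .
qed

text \<open>Composition with a measurable map can destroy Lebesgue measurability; with \<phi>
  simple, the composite is simple, hence measurable and bounded.\<close>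

lemma vertex_placements_pullback:
  assumes "f \<in> vertex_placements" "simple_function unit_measure \<phi>"
  shows "(\<lambda>x. f (\<phi> x)) \<in> vertex_placements"
proof -
  have s: "simple_function unit_measure (\<lambda>x. f (\<phi> x))"
    by (rule simple_function_compose1[OF assms(2)])
  then have "finite ((\<lambda>x. f (\<phi> x)) ` {0..1})"
    by (simp add: simple_function_def)
  then show ?thesis
    using borel_measurable_simple_function[OF s]
    by (simp add: vertex_placements_def finite_imp_bounded)
qed

text \<open>Each condition is quantified over all points, so it can be read at their images. Points
  merged by \<phi> cause no trouble: the edge between them becomes the one-point curve at the common
  vertex, and coinciding edges have equal images, which the intersection condition exempts.\<close>

lemma simple_graphon_drawing_pullback:
  assumes D: "simple_graphon_drawing D" and \<phi>: "\<And>x. x \<in> {0..1} \<Longrightarrow> \<phi> x \<in> {0..1}"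
  shows "simple_graphon_drawing (\<lambda>x y. D (\<phi> x) (\<phi> y))"
proof -
  have v: "drawing_vertex (\<lambda>x y. D (\<phi> x) (\<phi> y)) x = drawing_vertex D (\<phi> x)" for x
    by (simp add: drawing_vertex_def)
  show ?thesis
    using D unfolding simple_graphon_drawing_def v by (intro conjI ballI) (use \<phi> in meson)+
qed

lemma measurable_drawings_pullback:
  assumes "D \<in> measurable_drawings" "simple_function unit_measure \<phi>"
    and "\<And>x. x \<in> {0..1} \<Longrightarrow> \<phi> x \<in> {0..1}"
  shows "(\<lambda>x y. D (\<phi> x) (\<phi> y)) \<in> measurable_drawings"
proof -
  have "(\<lambda>(a, b, c, d). curves_meet (\<lambda>x y. D (\<phi> x) (\<phi> y)) a b c d) =
      (\<lambda>(a, b, c, d). curves_meet D (\<phi> a) (\<phi> b) (\<phi> c) (\<phi> d))"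
    by (simp add: curves_meet_def fun_eq_iff)
  moreover have "(\<lambda>(a, b, c, d). curves_meet D (\<phi> a) (\<phi> b) (\<phi> c) (\<phi> d)) \<in> borel_measurable (lebesgue_on unit_cube4)"
    by (rule borel_measurable_simple_function, rule simple_function_unit_cube4[OF assms(2)])
  ultimately show ?thesis
    using assms simple_graphon_drawing_pullback[of D \<phi>] by (simp add: measurable_drawings_def)
qed

lemma vertex_placements_nonempty: "vertex_placements \<noteq> {}"
proof -
  have "(\<lambda>x. 0) \<in> vertex_placements"
    by (simp add: vertex_placements_def image_constant_conv)
  then show ?thesis by blast
qed

text \<open>All vertices and edges sit at one point, so the kernel is constantly 1. Nonemptiness is
  what makes the infimum over the reals usable as a greatest lower bound.\<close>

lemma measurable_drawings_nonempty: "measurable_drawings \<noteq> {}"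
proof -
  let ?D = "\<lambda>(x::real) (y::real) (t::real). 0 :: real^2"
  have p: "path_image (\<lambda>t::real. 0 :: real^2) = {0}"
    by (simp add: path_image_def image_constant_conv)
  have "simple_graphon_drawing ?D"
    by (simp add: simple_graphon_drawing_def drawing_curves_def constant_on_def drawing_vertex_def p)
  moreover have "(\<lambda>(x, y, z, w). curves_meet ?D x y z w) = (\<lambda>_. 1)"
    by (simp add: curves_meet_def p fun_eq_iff)
  ultimately have "?D \<in> measurable_drawings"
    by (simp add: measurable_drawings_def)
  then show ?thesis by blast
qed

section \<open>Comparison of the infima\<close>

context partitioned_graphon begin

lemma crossing_integral_nonneg:
  assumes "\<And>a b c d. 0 \<le> J a b c d"
  shows "0 \<le> crossing_integral W J"
proof -
  have "0 \<le> (\<integral>(a, b, c, d). W a b * W c d * J a b c d \<partial>lebesgue_on unit_cube4)"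
    using W_bounds assms by (intro integral_nonneg_AE AE_I2) auto
  then show ?thesis
    by (simp add: crossing_integral_def)
qed

text \<open>Common form of both inequalities: a family of drawings closed, at the level of kernels,
  under pullback along simple maps of the unit interval to itself. Each pullback is a competitor for
  \<open>W\<close>, and its excess of at most \<open>1 / n\<close> can be made arbitrarily
  small.\<close>

lemma INF_crossing_integral_le:
  assumes "A \<noteq> {}"
    and meas: "\<And>D. D \<in> A \<Longrightarrow> (\<lambda>(a, b, c, d). J D a b c d) \<in> borel_measurable (lebesgue_on unit_cube4)"
    and J01: "\<And>D a b c d. 0 \<le> J D a b c d \<and> J D a b c d \<le> 1"
    and pullback: "\<And>D \<phi>. D \<in> A \<Longrightarrow> simple_function unit_measure \<phi> \<Longrightarrow> (\<And>x. x \<in> {0..1} \<Longrightarrow> \<phi> x \<in> {0..1}) \<Longrightarrow>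
      \<exists>D'\<in>A. J D' = (\<lambda>a b c d. J D (\<phi> a) (\<phi> b) (\<phi> c) (\<phi> d))"
  shows "(INF D\<in>A. crossing_integral W (J D)) \<le> (INF D\<in>A. crossing_integral (step_graphon P W) (J D))"
proof (rule cINF_greatest[OF \<open>A \<noteq> {}\<close>])
  fix D assume D: "D \<in> A"
  \<comment> \<open>Infima of reals are lower bounds only for families bounded below; 0 serves
    because crossing integrals of nonnegative kernels are nonnegative.\<close>
  have bdd: "bdd_below ((\<lambda>D. crossing_integral W (J D)) ` A)"
    by (rule bdd_belowI2[of _ 0]) (use J01 in \<open>blast intro: crossing_integral_nonneg\<close>)
  show "(INF D\<in>A. crossing_integral W (J D)) \<le> crossing_integral (step_graphon P W) (J D)"
  proof (rule field_le_epsilon)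
    fix e :: real assume "0 < e"
    then obtain n where n: "0 < n" "1 / real n < e"
      by (metis nat_approx_posE of_nat_Suc zero_less_Suc inverse_eq_divide)
    obtain \<phi> where \<phi>: "simple_function unit_measure \<phi>" "\<And>x. x \<in> {0..1} \<Longrightarrow> \<phi> x \<in> {0..1}"
      and le: "crossing_integral W (\<lambda>a b c d. J D (\<phi> a) (\<phi> b) (\<phi> c) (\<phi> d)) \<le>
        crossing_integral (step_graphon P W) (J D) + 1 / n"
      using crossing_integral_pullback_le[OF meas[OF D] J01 n(1)] by blast
    obtain D' where D': "D' \<in> A" "J D' = (\<lambda>a b c d. J D (\<phi> a) (\<phi> b) (\<phi> c) (\<phi> d))"
      using pullback[OF D \<phi>] by blast
    have "(INF D\<in>A. crossing_integral W (J D)) \<le> crossing_integral W (J D')"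
      by (rule cINF_lower[OF bdd D'(1)])
    with le n(2) show "(INF D\<in>A. crossing_integral W (J D)) \<le> crossing_integral (step_graphon P W) (J D) + e"
      by (simp add: D'(2))
  qed
qed

end

theorem theorem18:
  fixes W :: "real \<Rightarrow> real \<Rightarrow> real" and P :: "real set set"
  assumes "graphon W"
    and "finite P" and "partition_on {0..1} P" and "\<forall>S\<in>P. S \<in> sets lebesgue"
  shows "rectilinear_crossing_density W \<le> rectilinear_crossing_density (step_graphon P W) \<and>
         crossing_density W \<le> crossing_density (step_graphon P W)"
proof
  interpret partitioned_graphon W P
    by standard (use assms in auto)
  show "rectilinear_crossing_density W \<le> rectilinear_crossing_density (step_graphon P W)"
    unfolding rectilinear_crossing_density_def
  proof (rule INF_crossing_integral_le[OF vertex_placements_nonempty])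
    show "(\<lambda>(a, b, c, d). segments_meet (f a) (f b) (f c) (f d)) \<in> borel_measurable (lebesgue_on unit_cube4)"
      if "f \<in> vertex_placements" for f
      using that by (intro segments_meet_measurable) (simp add: vertex_placements_def)
    show "\<exists>f'\<in>vertex_placements. (\<lambda>a b c d. segments_meet (f' a) (f' b) (f' c) (f' d)) =
        (\<lambda>a b c d. segments_meet (f (\<phi> a)) (f (\<phi> b)) (f (\<phi> c)) (f (\<phi> d)))"
      if "f \<in> vertex_placements" "simple_function unit_measure \<phi>" for f \<phi>
      using vertex_placements_pullback[OF that] by (rule bexI[rotated]) (rule refl)
  qed (simp add: segments_meet_def)
  show "crossing_density W \<le> crossing_density (step_graphon P W)"
    unfolding crossing_density_def
  proof (rule INF_crossing_integral_le[OF measurable_drawings_nonempty])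
    show "(\<lambda>(a, b, c, d). curves_meet D a b c d) \<in> borel_measurable (lebesgue_on unit_cube4)"
      if "D \<in> measurable_drawings" for D
      using that by (simp add: measurable_drawings_def)
    show "\<exists>D'\<in>measurable_drawings. curves_meet D' = (\<lambda>a b c d. curves_meet D (\<phi> a) (\<phi> b) (\<phi> c) (\<phi> d))"
      if "D \<in> measurable_drawings" "simple_function unit_measure \<phi>" "\<And>x. x \<in> {0..1} \<Longrightarrow> \<phi> x \<in> {0..1}" for D \<phi>
    proof (rule bexI)
      show "(\<lambda>x y. D (\<phi> x) (\<phi> y)) \<in> measurable_drawings"
        by (rule measurable_drawings_pullback) (use that in auto)
    qed (simp add: curves_meet_def fun_eq_iff)
  qed (simp add: curves_meet_def)
qed

end
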